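(* Let $E\in\mathbb{R}$. Suppose that the equation $(\tau-E)f=0$ is nonoscillatory on $(a,b)$ and that the set of interaction points $M$ is countably infinite. Then $\mathbb{P}(B)=0$ for every measurable subset $B$ of $A(E):=\{\omega\in\Omega: E\in\sigma_p(H_\omega)\}$.
   Context: Probability space: let $I\subseteq\mathbb{Z}$ and let $\{p_n\}_{n\in I}$ be probability measures on $\mathbb{R}$ that are continuous, i.e. $p_n(\{r\})=0$ for all $r\in\mathbb{R}$. $\Omega$ denotes the completion of the product probability space $(\mathbb{R}^I,\mathcal{F},\mathbb{P})$, where $\mathbb{P}=\times_{n\in I}p_n$ and $\mathcal{F}$ is the product $\sigma$-algebra generated by cylinder sets; elements are sequences $\omega=\{\omega(n)\}_{n\in I}$, and "measurable" refers to the completed $\sigma$-algebra. Operators ($\delta$-interactions): let $-\infty\le a<b\le\infty$, let $V\in L^1_{loc}(a,b)$ be real valued, and let $M=\{x_n\}_{n\in I}\subset(a,b)$ be a discrete set of distinct points which accumulate at most at $a$ or $b$. Let $\tau f=-f''+Vf$. For $\omega\in\Omega$, the formal expression $\tau_\omega=-\frac{d^2}{dx^2}+V(x)+\sum_{n\in I}\omega(n)\delta(x-x_n)$ has maximal operator $T_\omega f=\tau f$ with domain $D(T_\omega)$ consisting of all $f\in L^2(a,b)$ such that $f,f'$ are (locally) absolutely continuous in $(a,b)\setminus M$, $-f''+Vf\in L^2(a,b)$, and $f(x_n+)=f(x_n-)$, $f'(x_n+)-f'(x_n-)=\omega(n)f(x_n)$ for all $n\in I$. A solution of $(\tau_\omega-z)f=0$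 ($z\in\mathbb{C}$) is a function $f$ with $f,f'$ (locally) absolutely continuous in $(a,b)\setminus M$, $-f''+Vf-zf=0$, satisfying the same conditions at all $x_n$. $\tau_\omega$ is regular at $a$ if $a$ is finite, $V\in L^1_{loc}[a,b)$ and $a$ is not an accumulation point of $M$; it is in the limit point case (lpc) at $a$ if for every $z\in\mathbb{C}$ there is at least one solution of $(\tau_\omega-z)f=0$ which is not square integrable near $a$; similarly at $b$. Standing assumption: at each of the endpoints $a$, $b$, $\tau_\omega$ is either regular or in the limit point case (for the operators $H_\omega$, $\omega\in\Omega$). For fixed $\theta,\gamma\in[0,\pi)$, $H_\omega$ is the selfadjoint restriction of $T_\omega$ to those $f\in D(T_\omega)$ satisfying $f(a)\cos\theta+f'(a)\sin\theta=0$ if $\tau_\omega$ is regular at $a$, and $f(b)\cos\gamma+f'(b)\sin\gamma=0$ if $\tau_\omega$ is regular at $b$ (no condition at an lpc endpoint). $\sigma_p(L)$ denotes the set of eigenvalues of $L$. Nonoscillation: the equation $(\tau-E)f=0$, i.e. $-f''+Vf=Ef$ (classical, no point interactions), is nonoscillatory on an interval $J$ if every nontrivial solution has at most finitely many zeros on $J$. *)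

theory Defs
  imports "HOL-Probability.Probability"
begin

section \<open>Local integrability, absolute continuity, square integrability\<close>

definition L1_loc :: "ereal \<Rightarrow> ereal \<Rightarrow> (real \<Rightarrow> real) \<Rightarrow> bool" where
  "L1_loc a b V \<longleftrightarrow> (\<forall>c d. {c..d} \<subseteq> einterval a b \<longrightarrow> V absolutely_integrable_on {c..d})"

text \<open>The finite families of non-overlapping compact subintervals of the usual
  epsilon-delta definition are rendered by \<^const>\<open>division_of\<close>.\<close>

definition abs_continuous_on :: "real set \<Rightarrow> (real \<Rightarrow> complex) \<Rightarrow> bool" where
  "abs_continuous_on S f \<longleftrightarrow>
     (\<forall>\<epsilon>>0. \<exists>\<delta>>0. \<forall>\<D>. \<D> division_of \<Union>\<D> \<longrightarrow> \<Union>\<D> \<subseteq> S \<longrightarrow>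
        (\<Sum>K\<in>\<D>. Sup K - Inf K) < \<delta> \<longrightarrow> (\<Sum>K\<in>\<D>. cmod (f (Sup K) - f (Inf K))) < \<epsilon>)"

definition loc_abs_continuous_on :: "real set \<Rightarrow> (real \<Rightarrow> complex) \<Rightarrow> bool" where
  "loc_abs_continuous_on S f \<longleftrightarrow> (\<forall>c d. {c..d} \<subseteq> S \<longrightarrow> abs_continuous_on {c..d} f)"

definition L2_on :: "real set \<Rightarrow> (real \<Rightarrow> complex) \<Rightarrow> bool" where
  "L2_on S f \<longleftrightarrow> f \<in> borel_measurable (lebesgue_on S) \<and>
     integrable (lebesgue_on S) (\<lambda>t. (cmod (f t))\<^sup>2)"

section \<open>The differential expression with point interactions\<close>

abbreviation D1 :: "(real \<Rightarrow> complex) \<Rightarrow> real \<Rightarrow> complex" where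
  "D1 f t \<equiv> vector_derivative f (at t)"

text \<open>The second derivative exists only almost everywhere for the functions to which
  \<open>tau\<close> is applied; the values elsewhere are irrelevant, because \<open>tau V f\<close> is
  only used up to null sets.\<close>

definition tau :: "(real \<Rightarrow> real) \<Rightarrow> (real \<Rightarrow> complex) \<Rightarrow> real \<Rightarrow> complex" where
  "tau V f t = - D1 (D1 f) t + complex_of_real (V t) * f t"

definition regularity_off :: "ereal \<Rightarrow> ereal \<Rightarrow> real set \<Rightarrow> (real \<Rightarrow> complex) \<Rightarrow> bool" where
  "regularity_off a b M f \<longleftrightarrow>
     (\<forall>t \<in> einterval a b - M. f differentiable (at t)) \<and>
     loc_abs_continuous_on (einterval a b - M) f \<and>
     loc_abs_continuous_on (einterval a b - M) (D1 f)"

text \<open>\<open>f(x+) = f(x-)\<close> and \<open>f'(x+) - f'(x-) = \<alpha> f(x)\<close>, the value \<open>f(x)\<close> being the common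
  one-sided limit.\<close>

definition delta_condition :: "real \<Rightarrow> real \<Rightarrow> (real \<Rightarrow> complex) \<Rightarrow> bool" where
  "delta_condition \<alpha> x f \<longleftrightarrow>
     (f \<longlongrightarrow> f x) (at_left x) \<and> (f \<longlongrightarrow> f x) (at_right x) \<and>
     (\<exists>l r. (D1 f \<longlongrightarrow> l) (at_left x) \<and> (D1 f \<longlongrightarrow> r) (at_right x) \<and>
        r - l = complex_of_real \<alpha> * f x)"

text \<open>Solutions of \<open>(\<tau>\<^sub>\<omega> - z) f = 0\<close>. For \<open>I = {}\<close> there are no point interactions and one
  obtains the solutions of the classical equation \<open>- f'' + V f = z f\<close>.\<close>

definition solution ::
  "ereal \<Rightarrow> ereal \<Rightarrow> (real \<Rightarrow> real) \<Rightarrow> int set \<Rightarrow> (int \<Rightarrow> real) \<Rightarrow> (int \<Rightarrow> real) \<Rightarrow>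
   complex \<Rightarrow> (real \<Rightarrow> complex) \<Rightarrow> bool" where
  "solution a b V I x \<omega> z f \<longleftrightarrow>
     regularity_off a b (x ` I) f \<and>
     (AE t in lebesgue_on (einterval a b). tau V f t - z * f t = 0) \<and>
     (\<forall>n\<in>I. delta_condition (\<omega> n) (x n) f)"

abbreviation classical_solution ::
  "ereal \<Rightarrow> ereal \<Rightarrow> (real \<Rightarrow> real) \<Rightarrow> complex \<Rightarrow> (real \<Rightarrow> complex) \<Rightarrow> bool" where
  "classical_solution a b V z f \<equiv> solution a b V {} (\<lambda>_. 0) (\<lambda>_. 0) z f"

definition nonoscillatory :: "ereal \<Rightarrow> ereal \<Rightarrow> (real \<Rightarrow> real) \<Rightarrow> real \<Rightarrow> bool" where
  "nonoscillatory a b V E \<longleftrightarrow>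
     (\<forall>f. classical_solution a b V (complex_of_real E) f \<and> (\<exists>t \<in> einterval a b. f t \<noteq> 0) \<longrightarrow>
        finite {t \<in> einterval a b. f t = 0})"

section \<open>Classification of the endpoints\<close>

definition regular_left :: "ereal \<Rightarrow> ereal \<Rightarrow> (real \<Rightarrow> real) \<Rightarrow> real set \<Rightarrow> bool" where
  "regular_left a b V M \<longleftrightarrow>
     \<bar>a\<bar> \<noteq> \<infinity> \<and>
     (\<forall>d \<in> einterval a b. V absolutely_integrable_on {real_of_ereal a..d}) \<and>
     \<not> real_of_ereal a islimpt M"

definition regular_right :: "ereal \<Rightarrow> ereal \<Rightarrow> (real \<Rightarrow> real) \<Rightarrow> real set \<Rightarrow> bool" where
  "regular_right a b V M \<longleftrightarrow>
     \<bar>b\<bar> \<noteq> \<infinity> \<and>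
     (\<forall>c \<in> einterval a b. V absolutely_integrable_on {c..real_of_ereal b}) \<and>
     \<not> real_of_ereal b islimpt M"

definition lpc_left ::
  "ereal \<Rightarrow> ereal \<Rightarrow> (real \<Rightarrow> real) \<Rightarrow> int set \<Rightarrow> (int \<Rightarrow> real) \<Rightarrow> (int \<Rightarrow> real) \<Rightarrow> bool" where
  "lpc_left a b V I x \<omega> \<longleftrightarrow>
     (\<forall>z. \<exists>f. solution a b V I x \<omega> z f \<and>
        \<not> (\<exists>c \<in> einterval a b. L2_on (einterval a (ereal c)) f))"

definition lpc_right ::
  "ereal \<Rightarrow> ereal \<Rightarrow> (real \<Rightarrow> real) \<Rightarrow> int set \<Rightarrow> (int \<Rightarrow> real) \<Rightarrow> (int \<Rightarrow> real) \<Rightarrow> bool" where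
  "lpc_right a b V I x \<omega> \<longleftrightarrow>
     (\<forall>z. \<exists>f. solution a b V I x \<omega> z f \<and>
        \<not> (\<exists>c \<in> einterval a b. L2_on (einterval (ereal c) b) f))"

section \<open>The operators\<close>

text \<open>Elements of \<open>L\<^sup>2(a,b)\<close> are represented by functions on the line whose values outside
  \<open>(a,b)\<close> are irrelevant; an operator is given by its domain together with its action.\<close>

definition T_dom ::
  "ereal \<Rightarrow> ereal \<Rightarrow> (real \<Rightarrow> real) \<Rightarrow> int set \<Rightarrow> (int \<Rightarrow> real) \<Rightarrow> (int \<Rightarrow> real) \<Rightarrow>
   (real \<Rightarrow> complex) set" where
  "T_dom a b V I x \<omega> = {f.
     L2_on (einterval a b) f \<and> regularity_off a b (x ` I) f \<and>
     L2_on (einterval a b) (tau V f) \<and> (\<forall>n\<in>I. delta_condition (\<omega> n) (x n) f)}"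

text \<open>\<open>f cos \<phi> + f' sin \<phi> = 0\<close> at an endpoint, for the limits of \<open>f\<close> and \<open>f'\<close> along \<open>F\<close>.\<close>

definition boundary_condition :: "real filter \<Rightarrow> real \<Rightarrow> (real \<Rightarrow> complex) \<Rightarrow> bool" where
  "boundary_condition F \<phi> f \<longleftrightarrow>
     (\<exists>u v. (f \<longlongrightarrow> u) F \<and> (D1 f \<longlongrightarrow> v) F \<and>
        u * complex_of_real (cos \<phi>) + v * complex_of_real (sin \<phi>) = 0)"

definition H_dom ::
  "ereal \<Rightarrow> ereal \<Rightarrow> (real \<Rightarrow> real) \<Rightarrow> int set \<Rightarrow> (int \<Rightarrow> real) \<Rightarrow> real \<Rightarrow> real \<Rightarrow>
   (int \<Rightarrow> real) \<Rightarrow> (real \<Rightarrow> complex) set" where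
  "H_dom a b V I x \<theta> \<gamma> \<omega> = {f \<in> T_dom a b V I x \<omega>.
     (regular_left a b V (x ` I) \<longrightarrow>
        boundary_condition (at_right (real_of_ereal a)) \<theta> f) \<and>
     (regular_right a b V (x ` I) \<longrightarrow>
        boundary_condition (at_left (real_of_ereal b)) \<gamma> f)}"

definition point_spectrum ::
  "real set \<Rightarrow> (real \<Rightarrow> complex) set \<Rightarrow> ((real \<Rightarrow> complex) \<Rightarrow> real \<Rightarrow> complex) \<Rightarrow> complex set" where
  "point_spectrum S D L = {z. \<exists>f\<in>D. \<not> (AE t in lebesgue_on S. f t = 0) \<and>
     (AE t in lebesgue_on S. L f t = z * f t)}"

definition H_point_spectrum ::
  "ereal \<Rightarrow> ereal \<Rightarrow> (real \<Rightarrow> real) \<Rightarrow> int set \<Rightarrow> (int \<Rightarrow> real) \<Rightarrow> real \<Rightarrow> real \<Rightarrow>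
   (int \<Rightarrow> real) \<Rightarrow> complex set" where
  "H_point_spectrum a b V I x \<theta> \<gamma> \<omega> =
     point_spectrum (einterval a b) (H_dom a b V I x \<theta> \<gamma> \<omega>) (tau V)"

section \<open>The probability space\<close>

definition Omega :: "int set \<Rightarrow> (int \<Rightarrow> real measure) \<Rightarrow> (int \<Rightarrow> real) measure" where
  "Omega I p = completion (PiM I p)"

definition A_set ::
  "ereal \<Rightarrow> ereal \<Rightarrow> (real \<Rightarrow> real) \<Rightarrow> int set \<Rightarrow> (int \<Rightarrow> real) \<Rightarrow> real \<Rightarrow> real \<Rightarrow>
   (int \<Rightarrow> real measure) \<Rightarrow> real \<Rightarrow> (int \<Rightarrow> real) set" where
  "A_set a b V I x \<theta> \<gamma> p E =
     {\<omega> \<in> space (Omega I p). complex_of_real E \<in> H_point_spectrum a b V I x \<theta> \<gamma> \<omega>}"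

end

theory Submission
  imports Defs
begin

text \<open>
Suppose that a measurable set \<open>B\<close> of couplings for which \<open>E\<close> is an eigenvalue has positive
measure. Because each \<open>p\<^sub>n\<close> has no atoms, Fubini's theorem shows that for almost every
\<open>\<omega> \<in> B\<close> and every \<open>n\<close> simultaneously, the single coordinate \<open>\<omega>(n)\<close> can be moved to some other
value without leaving \<open>B\<close>. This is lemma \<open>positive_set_has_point_with_movable_coordinates\<close>. Fix
such an \<open>\<omega>\<close>, and an eigenfunction \<open>f\<close> of \<open>H\<^sub>\<omega>\<close> for \<open>E\<close>.

Changing one coupling is a rank-one perturbation, and it can keep an eigenvalue only if
the eigenfunction does not see it. In detail, let \<open>\<omega>'\<close> differ from \<open>\<omega>\<close> at \<open>n\<close> only and let \<open>g\<close>
be an eigenfunction of \<open>H\<^bsub>\<omega>'\<^esub>\<close> for \<open>E\<close>. The Wronskian of \<open>f\<close> and \<open>g\<close> is constant on each side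
of \<open>x\<^sub>n\<close>, since at every other interaction point both functions satisfy the same
condition. It vanishes on both sides: at a regular endpoint because of the boundary condition,
at a limit point endpoint because otherwise \<open>f\<close> and \<open>g\<close> would be two independent square
integrable solutions, and every solution is a combination of them
(\<open>wronskian_vanishes_left\<close>, \<open>wronskian_vanishes_right\<close>). The jump of the Wronskian at \<open>x\<^sub>n\<close> is
\<open>(\<omega>'(n) - \<omega>(n)) f(x\<^sub>n) g(x\<^sub>n)\<close>, hence \<open>f(x\<^sub>n) g(x\<^sub>n) = 0\<close>. If \<open>f(x\<^sub>n)\<close> were nonzero, then \<open>g\<close> would
vanish at \<open>x\<^sub>n\<close>, and the vanishing Wronskian would force the one-sided derivative of \<open>g\<close> to
vanish there too; uniqueness of the Cauchy problem would give \<open>g = 0\<close>. So \<open>f(x\<^sub>n) = 0\<close>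
(\<open>eigenfunction_vanishes_at_movable_coupling\<close>).

Consequently \<open>f\<close> vanishes at all the infinitely many interaction points. There the jump
conditions become void, so that \<open>f\<close> is a nontrivial solution of the classical equation
(\<open>solution_vanishing_at_points_is_classical\<close>). It has infinitely many zeros, which contradicts
nonoscillation.

The equation is only assumed to hold almost everywhere, with \<open>f'\<close> locally absolutely
continuous. Turning it into an integral equation needs two classical facts which are proved
first: an absolutely continuous function is differentiable almost everywhere
(\<open>abs_continuous_negligible_not_differentiable\<close>), and it is the integral of its derivative
(\<open>abs_continuous_has_integral\<close>).
\<close>

section \<open>Functions of bounded variation are differentiable almost everywhere\<close>

definition var_sum :: "(real \<Rightarrow> real) \<Rightarrow> real set set \<Rightarrow> real" where
  "var_sum F \<D> = (\<Sum>K\<in>\<D>. \<bar>F (Sup K) - F (Inf K)\<bar>)"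

definition partial_divisions :: "real set \<Rightarrow> real set set set" where
  "partial_divisions S = {\<D>. \<D> division_of \<Union>\<D> \<and> \<Union>\<D> \<subseteq> S}"

definition total_var :: "(real \<Rightarrow> real) \<Rightarrow> real set \<Rightarrow> real" where
  "total_var F S = Sup (var_sum F ` partial_divisions S)"

lemma sum_increments_division:
  fixes F :: "real \<Rightarrow> 'a::real_normed_vector"
  assumes "u \<le> v" and D: "\<D> division_of {u..v}"
  shows "(\<Sum>K\<in>\<D>. F (Sup K) - F (Inf K)) = F v - F u"
proof -
  define p where "p = (\<lambda>K. (Inf K, K)) ` \<D>"
  have *: "\<exists>c d. K = {c..d} \<and> c \<le> d" if "K \<in> \<D>" for K
    using division_ofD(3,4)[OF D that] by fastforce
  have p: "p tagged_division_of {u..v}"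
  proof (rule tagged_division_ofI)
    show "finite p"
      using D by (auto simp: p_def)
    show "x \<in> K" "K \<subseteq> {u..v}" "\<exists>a b. K = cbox a b" if "(x, K) \<in> p" for x K
      using that * division_ofD(2,4)[OF D] by (fastforce simp: p_def)+
    show "interior K1 \<inter> interior K2 = {}"
      if "(x1, K1) \<in> p" "(x2, K2) \<in> p" "(x1, K1) \<noteq> (x2, K2)" for x1 K1 x2 K2
      using that division_ofD(5)[OF D, of K1 K2] by (auto simp: p_def)
    have "{K. \<exists>x. (x, K) \<in> p} = \<D>"
      by (auto simp: p_def)
    then show "\<Union>{K. \<exists>x. (x, K) \<in> p} = {u..v}"
      using division_ofD(6)[OF D] by simp
  qed
  have "(\<Sum>(x,K)\<in>p. F (Sup K) - F (Inf K)) = (\<Sum>K\<in>\<D>. F (Sup K) - F (Inf K))"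
    unfolding p_def by (subst sum.reindex) (auto simp: inj_on_def)
  with additive_tagged_division_1[OF \<open>u \<le> v\<close> p, of F] show ?thesis
    by simp
qed

text \<open>The form in which the Vitali covering theorem is used below: if a set is finely covered by
intervals with a property \<open>Q\<close>, and non-overlapping intervals with that property have total length at
most \<open>m\<close>, then the outer measure of the set is at most \<open>m\<close>. The point \<open>t\<close> may be an endpoint of
its covering intervals, so that one-sided difference quotients are included.\<close>

lemma Vitali_interval_cover:
  fixes S :: "real set" and Q :: "real \<Rightarrow> real \<Rightarrow> bool"
  assumes cover: "\<And>t \<delta>. t \<in> S \<Longrightarrow> \<delta> > 0 \<Longrightarrow>
        \<exists>c d. c < d \<and> t \<in> {c..d} \<and> {c..d} \<subseteq> P \<and> d - c < \<delta> \<and> Q c d"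
    and bound: "\<And>\<K>. \<K> \<in> partial_divisions P \<Longrightarrow>
        (\<And>K. K \<in> \<K> \<Longrightarrow> \<exists>c d. K = {c..d} \<and> c < d \<and> Q c d) \<Longrightarrow>
        (\<Sum>K\<in>\<K>. Sup K - Inf K) \<le> m"
  obtains U where "S \<subseteq> U" "U \<in> lmeasurable" "measure lebesgue U \<le> m"
proof -
  \<comment> \<open>An interval is encoded by its endpoints; the covering theorem speaks of centres and radii.\<close>
  define J where "J = {(c,d). c < d \<and> {c..d} \<subseteq> P \<and> Q c d}"
  define mid where "mid = (\<lambda>(c,d). (c + d) / 2 :: real)"
  define rad where "rad = (\<lambda>(c,d). (d - c) / 2 :: real)"
  have cb: "cball (mid i) (rad i) = {fst i..snd i}" for i
    by (cases i) (auto simp: mid_def rad_def cball_eq_atLeastAtMost field_simps)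
  obtain C where C: "countable C" "C \<subseteq> J"
     "pairwise (\<lambda>i j. disjnt (cball (mid i) (rad i)) (cball (mid j) (rad j))) C"
     "negligible (S - (\<Union>i\<in>C. cball (mid i) (rad i)))"
  proof (rule Vitali_covering_theorem_cballs[of J rad S mid])
    show "0 < rad i" if "i \<in> J" for i
      using that by (auto simp: J_def rad_def)
    show "\<exists>i. i \<in> J \<and> t \<in> cball (mid i) (rad i) \<and> rad i < d" if t: "t \<in> S" and d: "0 < d" for t d
    proof -
      obtain c e where "c < e \<and> t \<in> {c..e} \<and> {c..e} \<subseteq> P \<and> e - c < d \<and> Q c e"
        using cover[OF t d] by blast
      then show ?thesis
        unfolding cb by (intro exI[of _ "(c,e)"]) (auto simp: J_def rad_def)
    qed
  qed blast
  define W where "W = (\<Union>i\<in>C. {fst i..snd i})"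
  have fin: "measure lebesgue (\<Union>i\<in>I'. {fst i..snd i}) \<le> m" if I': "I' \<subseteq> C" "finite I'" for I'
  proof -
    define \<K> where "\<K> = (\<lambda>i. {fst i..snd i}) ` I'"
    have lt: "fst i < snd i" "{fst i..snd i} \<subseteq> P" "Q (fst i) (snd i)" if "i \<in> I'" for i
      using subsetD[OF C(2) subsetD[OF I'(1) that]] by (auto simp: J_def split: prod.splits)
    have inj: "inj_on (\<lambda>i. {fst i..snd i}) I'"
      using lt(1) by (auto simp: inj_on_def Icc_eq_Icc prod_eq_iff intro: less_imp_le)
    have "measure lebesgue (\<Union>i\<in>I'. {fst i..snd i}) \<le> (\<Sum>i\<in>I'. measure lebesgue {fst i..snd i})"
      using I' by (intro measure_UNION_le) auto
    also have "\<dots> = (\<Sum>i\<in>I'. snd i - fst i)"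
      using lt(1) by (intro sum.cong) (auto simp: less_imp_le)
    also have "\<dots> = (\<Sum>K\<in>\<K>. Sup K - Inf K)"
      unfolding \<K>_def using lt(1) by (subst sum.reindex[OF inj]) (auto intro!: sum.cong simp: less_imp_le)
    also have "\<dots> \<le> m"
    proof (rule bound)
      have "\<K> division_of \<Union>\<K>"
      proof (rule division_ofI)
        show "interior K1 \<inter> interior K2 = {}" if K: "K1 \<in> \<K>" "K2 \<in> \<K>" "K1 \<noteq> K2" for K1 K2
        proof -
          obtain i j where ij: "i \<in> I'" "j \<in> I'" "K1 = {fst i..snd i}" "K2 = {fst j..snd j}"
            using K by (auto simp: \<K>_def)
          then have "i \<noteq> j" "i \<in> C" "j \<in> C"
            using K(3) I'(1) by auto
          then have "disjnt K1 K2"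
            using pairwiseD[OF C(3), of i j] ij unfolding cb by simp
          then show ?thesis
            using interior_subset by (fastforce simp: disjnt_def)
        qed
      qed (use I' lt in \<open>auto simp: \<K>_def less_imp_le intro: exI\<close>)
      then show "\<K> \<in> partial_divisions P"
        using lt(2) by (auto simp: partial_divisions_def \<K>_def)
    next
      show "\<exists>c d. K = {c..d} \<and> c < d \<and> Q c d" if "K \<in> \<K>" for K
        using that lt(1,3) unfolding \<K>_def by blast
    qed
    finally show ?thesis .
  qed
  have W: "W \<in> lmeasurable" "measure lebesgue W \<le> m"
    unfolding W_def by (rule fmeasurable_UN_bound[OF C(1) _ fin] measure_UN_bound[OF C(1) _ fin]; simp)+
  define N where "N = S - W"
  have N: "negligible N"
    using C(4) by (simp add: N_def W_def cb)
  show ?thesis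
  proof
    show "S \<subseteq> W \<union> N"
      by (auto simp: N_def)
    show "W \<union> N \<in> lmeasurable"
      using W N negligible_imp_measurable by blast
    have "measure lebesgue (W \<union> N) \<le> measure lebesgue W + measure lebesgue N"
      using W N by (intro measure_Un_le) (auto dest: negligible_imp_measurable)
    then show "measure lebesgue (W \<union> N) \<le> m"
      using W N negligible_imp_measure0 by fastforce
  qed
qed

locale bounded_var =
  fixes F :: "real \<Rightarrow> real" and u v B :: real
  assumes bv: "\<And>\<D>. \<D> \<in> partial_divisions {u..v} \<Longrightarrow> var_sum F \<D> \<le> B"
begin

lemma bdd_above_var_sum:
  assumes "S \<subseteq> {u..v}" shows "bdd_above (var_sum F ` partial_divisions S)"
  by (rule bdd_aboveI2[of _ _ B]) (use assms bv in \<open>auto simp: partial_divisions_def\<close>)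

lemma var_sum_le_total_var:
  assumes "S \<subseteq> {u..v}" "\<D> \<in> partial_divisions S"
  shows "var_sum F \<D> \<le> total_var F S"
  unfolding total_var_def using cSUP_upper[OF assms(2) bdd_above_var_sum[OF assms(1)]] .

lemma near_total_var:
  assumes "S \<subseteq> {u..v}" "\<eta> > 0"
  obtains \<D> where "\<D> \<in> partial_divisions S" "var_sum F \<D> > total_var F S - \<eta>"
proof -
  have "{} \<in> partial_divisions S"
    by (auto simp: partial_divisions_def)
  then have "var_sum F ` partial_divisions S \<noteq> {}"
    by blast
  then have "\<exists>x\<in>var_sum F ` partial_divisions S. total_var F S - \<eta> < x"
    unfolding total_var_def by (intro less_cSupD) (use assms(2) in auto)
  with that show ?thesis
    by blast
qed

text \<open>Near-optimal divisions of the members of \<open>\<D>\<close> together form a partial division of \<open>[u,v]\<close>.\<close>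

lemma total_var_superadditive:
  assumes D: "\<D> \<in> partial_divisions {u..v}"
  shows "(\<Sum>P\<in>\<D>. total_var F P) \<le> total_var F {u..v}"
proof (rule field_le_epsilon)
  fix e :: real assume "e > 0"
  define \<eta> where "\<eta> = e / (1 + real (card \<D>))"
  have "\<eta> > 0"
    using \<open>e > 0\<close> by (simp add: \<eta>_def)
  have div: "\<D> division_of \<Union>\<D>" and sub: "\<And>P. P \<in> \<D> \<Longrightarrow> P \<subseteq> {u..v}"
    using D by (auto simp: partial_divisions_def)
  have "\<forall>P\<in>\<D>. \<exists>\<E>. \<E> \<in> partial_divisions P \<and> var_sum F \<E> > total_var F P - \<eta>"
    using near_total_var[OF sub \<open>\<eta> > 0\<close>] by metis
  then obtain \<E> where E: "\<And>P. P \<in> \<D> \<Longrightarrow> \<E> P \<in> partial_divisions P"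
     "\<And>P. P \<in> \<D> \<Longrightarrow> var_sum F (\<E> P) > total_var F P - \<eta>"
    by metis
  have E': "\<E> P division_of \<Union>(\<E> P)" "\<And>K. K \<in> \<E> P \<Longrightarrow> K \<subseteq> P" if "P \<in> \<D>" for P
    using E(1)[OF that] by (auto simp: partial_divisions_def)
  have fin: "finite \<D>" "\<And>P. P \<in> \<D> \<Longrightarrow> finite (\<E> P)"
    using div E' by auto
  have int: "interior K1 \<inter> interior K2 = {}"
    if "P1 \<in> \<D>" "P2 \<in> \<D>" "K1 \<in> \<E> P1" "K2 \<in> \<E> P2" "K1 \<noteq> K2 \<or> P1 \<noteq> P2" for P1 P2 K1 K2
  proof (cases "P1 = P2")
    case True
    with that division_ofD(5)[OF E'(1)[of P1], of K1 K2] show ?thesis by auto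
  next
    case False
    then have "interior P1 \<inter> interior P2 = {}"
      using division_ofD(5)[OF div] that by blast
    then show ?thesis
      using interior_mono[OF E'(2)[of P1 K1]] interior_mono[OF E'(2)[of P2 K2]] that by blast
  qed
  define \<F> where "\<F> = (\<Union>P\<in>\<D>. \<E> P)"
  have "\<F> division_of \<Union>\<F>"
    unfolding \<F>_def
  proof (rule division_of_Union)
    show "finite (\<E> ` \<D>)"
      using fin by auto
    show "p division_of \<Union>p" if "p \<in> \<E> ` \<D>" for p
      using that E'(1) by blast
    show "interior K1 \<inter> interior K2 = {}"
      if "K1 \<in> \<Union>(\<E> ` \<D>)" "K2 \<in> \<Union>(\<E> ` \<D>)" "K1 \<noteq> K2" for K1 K2
      using that int by blast
  qed
  moreover have "\<Union>\<F> \<subseteq> {u..v}"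
    using E'(2) sub by (auto simp: \<F>_def) (meson atLeastAtMost_iff subsetD)+
  ultimately have "var_sum F \<F> \<le> total_var F {u..v}"
    by (intro var_sum_le_total_var) (auto simp: partial_divisions_def)
  also have "var_sum F \<F> = (\<Sum>P\<in>\<D>. var_sum F (\<E> P))"
    unfolding \<F>_def var_sum_def
  proof -
    let ?g = "\<lambda>K. \<bar>F (Sup K) - F (Inf K)\<bar>"
    \<comment> \<open>The divisions of different members can share only degenerate intervals, which do not
      contribute to the sums.\<close>
    have g0: "?g K = 0" if K: "P1 \<in> \<D>" "P2 \<in> \<D>" "P1 \<noteq> P2" "K \<in> \<E> P1" "K \<in> \<E> P2" for P1 P2 K
    proof -
      have "interior K = {}"
        using int[of P1 P2 K K] K by auto
      moreover obtain c d where "K = {c..d}" "c \<le> d"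
        using division_ofD(3,4)[OF E'(1)[OF K(1)], of K] K by fastforce
      ultimately show ?thesis
        by auto
    qed
    have "sum ?g (\<Union>(\<E> ` \<D>)) = (\<Sum>X\<in>\<E> ` \<D>. sum ?g X)"
    proof (subst sum.Union_comp)
      show "\<forall>X\<in>\<E> ` \<D>. finite X"
        using fin(2) by blast
      show "?g K = 0" if "X1 \<in> \<E> ` \<D>" "X2 \<in> \<E> ` \<D>" "X1 \<noteq> X2" "K \<in> X1" "K \<in> X2" for X1 X2 K
        using that g0 by blast
    qed simp
    also have "\<dots> = (\<Sum>P\<in>\<D>. sum ?g (\<E> P))"
    proof (subst sum.reindex_nontrivial[OF fin(1)])
      show "sum ?g (\<E> P1) = 0" if "P1 \<in> \<D>" "P2 \<in> \<D>" "P1 \<noteq> P2" "\<E> P1 = \<E> P2" for P1 P2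
        using that g0[of P1 P2] by (intro sum.neutral) auto
    qed simp
    finally show "sum ?g (\<Union>(\<E> ` \<D>)) = (\<Sum>P\<in>\<D>. sum ?g (\<E> P))" .
  qed
  finally have "(\<Sum>P\<in>\<D>. var_sum F (\<E> P)) \<le> total_var F {u..v}" .
  moreover have "(\<Sum>P\<in>\<D>. total_var F P) \<le> (\<Sum>P\<in>\<D>. var_sum F (\<E> P) + \<eta>)"
    using E(2) by (intro sum_mono) (smt (verit))
  moreover have "real (card \<D>) * \<eta> \<le> e"
    using \<open>e > 0\<close> by (simp add: \<eta>_def field_simps)
  ultimately show "(\<Sum>P\<in>\<D>. total_var F P) \<le> total_var F {u..v} + e"
    by (simp add: sum.distrib)
qed

text \<open>The key estimate for differentiability. If \<open>F\<close> descends along the intervals \<open>\<K>\<close> although its net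
increment over \<open>[c,d]\<close> is nonnegative, then the rest of the interval has to make up for this
descent; so the descent is counted twice in the variation, on top of the net increment. The sign
\<open>s\<close> covers the case of a nonpositive increment.\<close>

lemma total_var_gain_from_opposite_increments:
  assumes uv: "u \<le> c" "c \<le> d" "d \<le> v"
    and K: "\<K> \<in> partial_divisions {c..d}"
    and \<epsilon>: "\<And>K. K \<in> \<K> \<Longrightarrow> s * (F (Sup K) - F (Inf K)) \<le> - \<epsilon> * (Sup K - Inf K)"
    and s: "s = 1 \<or> s = -1" "0 \<le> s * (F d - F c)"
  shows "\<bar>F d - F c\<bar> + 2 * \<epsilon> * (\<Sum>K\<in>\<K>. Sup K - Inf K) \<le> total_var F {c..d}"
proof -
  have "\<K> division_of \<Union>\<K>" "\<Union>\<K> \<subseteq> cbox c d"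
    using K by (auto simp: partial_divisions_def)
  then obtain \<D> where D: "\<K> \<subseteq> \<D>" "\<D> division_of {c..d}"
    using partial_division_extend_interval by (metis box_real(2))
  let ?g = "\<lambda>K. s * (F (Sup K) - F (Inf K))"
  have fin: "finite \<D>" "finite \<K>"
    using D finite_subset by auto
  have sum: "sum ?g \<D> = \<bar>F d - F c\<bar>"
    using sum_increments_division[OF uv(2) D(2), of F] s by (auto simp: sum_distrib_left[symmetric])
  have "\<bar>F d - F c\<bar> + 2 * \<epsilon> * (\<Sum>K\<in>\<K>. Sup K - Inf K) = 
      sum ?g (\<D> - \<K>) + (\<Sum>K\<in>\<K>. ?g K + 2 * \<epsilon> * (Sup K - Inf K))"
    using sum.subset_diff[OF D(1) fin(1), of ?g] sum by (simp add: sum.distrib sum_distrib_left)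
  also have "\<dots> \<le> (\<Sum>K\<in>\<D>-\<K>. \<bar>F (Sup K) - F (Inf K)\<bar>) + (\<Sum>K\<in>\<K>. \<bar>F (Sup K) - F (Inf K)\<bar>)"
  proof (intro add_mono sum_mono)
    show "?g K \<le> \<bar>F (Sup K) - F (Inf K)\<bar>" for K
      using s(1) by auto
    show "?g K + 2 * \<epsilon> * (Sup K - Inf K) \<le> \<bar>F (Sup K) - F (Inf K)\<bar>" if "K \<in> \<K>" for K
    proof -
      have "\<bar>?g K\<bar> = \<bar>F (Sup K) - F (Inf K)\<bar>"
        using s(1) by auto
      then show ?thesis
        using \<epsilon>[OF that] by linarith
    qed
  qed
  also have "\<dots> = var_sum F \<D>"
    unfolding var_sum_def by (rule sum.subset_diff[OF D(1) fin(1), symmetric])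
  also have "\<dots> \<le> total_var F {c..d}"
    using D(2) uv by (intro var_sum_le_total_var) (auto simp: partial_divisions_def)
  finally show ?thesis .
qed

text \<open>Through these points there are arbitrarily short intervals on which the mean slope of \<open>F\<close> is at
least \<open>\<epsilon>\<close>, and others on which it is at most \<open>-\<epsilon>\<close>.\<close>

definition oscillating :: "real \<Rightarrow> real set" where
  "oscillating \<epsilon> = {t. \<forall>\<delta>>0. \<forall>s\<in>{1,-1}. \<exists>c d. c < d \<and> t \<in> {c..d} \<and> d - c < \<delta> \<and>
      s * (F d - F c) \<le> - \<epsilon> * (d - c)}"

lemma oscillatingD:
  assumes "t \<in> oscillating \<epsilon>" "\<delta> > 0" "s = 1 \<or> s = -1"
  shows "\<exists>c d. c < d \<and> t \<in> {c..d} \<and> d - c < \<delta> \<and> s * (F d - F c) \<le> - \<epsilon> * (d - c)"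
  using assms unfolding oscillating_def by blast

text \<open>Take a division whose variation sum is within \<open>2 \<epsilon> e\<close> of the supremum. In each of its members,
cover the oscillating points by short intervals along which \<open>F\<close> moves against the net
increment. By the preceding estimate their total length times \<open>2 \<epsilon>\<close> is at most the amount by which
the division falls short of the supremum.\<close>

lemma negligible_oscillating:
  assumes \<epsilon>: "\<epsilon> > 0"
  shows "negligible (oscillating \<epsilon> \<inter> {u..v})"
proof -
  have "\<exists>T. oscillating \<epsilon> \<inter> {u..v} \<subseteq> T \<and> T \<in> lmeasurable \<and> measure lebesgue T \<le> e" if e: "e > 0" for e
  proof (cases "u \<le> v")
    case True
    obtain \<D> where D: "\<D> \<in> partial_divisions {u..v}" "var_sum F \<D> > total_var F {u..v} - 2 * \<epsilon> * e"
      using near_total_var[of "{u..v}" "2 * \<epsilon> * e"] \<epsilon> e by auto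
    obtain \<D>' where D': "\<D> \<subseteq> \<D>'" "\<D>' division_of {u..v}"
      using partial_division_extend_interval D(1) by (metis (no_types, lifting) box_real(2) mem_Collect_eq partial_divisions_def)
    have fin: "finite \<D>'"
      using D' by auto
    have "var_sum F \<D> \<le> var_sum F \<D>'"
      unfolding var_sum_def using D' fin by (intro sum_mono2) auto
    then have near: "total_var F {u..v} - var_sum F \<D>' < 2 * \<epsilon> * e"
      using D(2) by linarith
    define m where "m P = (total_var F P - \<bar>F (Sup P) - F (Inf P)\<bar>) / (2 * \<epsilon>)" for P
    have "\<exists>U. oscillating \<epsilon> \<inter> interior P \<subseteq> U \<and> U \<in> lmeasurable \<and> measure lebesgue U \<le> m P"
      if P: "P \<in> \<D>'" for P
    proof -
      obtain c d where cd: "P = {c..d}" "c \<le> d" "u \<le> c" "d \<le> v"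
        using division_ofD(2,3,4)[OF D'(2) P] by fastforce
      \<comment> \<open>The direction of the net increment; the covering intervals are chosen against it.\<close>
      obtain s :: real where s: "s = 1 \<or> s = -1" "0 \<le> s * (F d - F c)"
        by (metis linorder_linear mult_1 mult_minus1 neg_0_le_iff_le)
      obtain U where "oscillating \<epsilon> \<inter> interior P \<subseteq> U" "U \<in> lmeasurable" "measure lebesgue U \<le> m P"
      proof (rule Vitali_interval_cover[of "oscillating \<epsilon> \<inter> interior P" P
            "\<lambda>c d. s * (F d - F c) \<le> - \<epsilon> * (d - c)" "m P"])
        fix t \<delta> :: real assume t: "t \<in> oscillating \<epsilon> \<inter> interior P" and \<delta>: "\<delta> > 0"
        then have t': "c < t" "t < d"
          using cd by auto
        define \<delta>' where "\<delta>' = min \<delta> (min (t - c) (d - t))"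
        have "\<delta>' > 0"
          using t' \<delta> by (auto simp: \<delta>'_def)
        then obtain c' d' where "c' < d'" "t \<in> {c'..d'}" "d' - c' < \<delta>'" 
           "s * (F d' - F c') \<le> - \<epsilon> * (d' - c')"
          using oscillatingD[of t \<epsilon> \<delta>' s] t s(1) by blast
        then show "\<exists>c d. c < d \<and> t \<in> {c..d} \<and> {c..d} \<subseteq> P \<and> d - c < \<delta> \<and> s * (F d - F c) \<le> - \<epsilon> * (d - c)"
          by (intro exI[of _ c'] exI[of _ d']) (auto simp: \<delta>'_def cd)
      next
        fix \<K> assume K: "\<K> \<in> partial_divisions P"
          "\<And>K. K \<in> \<K> \<Longrightarrow> \<exists>c d. K = {c..d} \<and> c < d \<and> s * (F d - F c) \<le> - \<epsilon> * (d - c)"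
        have "\<bar>F d - F c\<bar> + 2 * \<epsilon> * (\<Sum>K\<in>\<K>. Sup K - Inf K) \<le> total_var F {c..d}"
          by (rule total_var_gain_from_opposite_increments[OF _ _ _ _ _ s]) (use cd K in fastforce)+
        then show "(\<Sum>K\<in>\<K>. Sup K - Inf K) \<le> m P"
          using \<epsilon> cd by (simp add: m_def field_simps)
      qed blast
      then show ?thesis
        by blast
    qed
    then obtain U where U: "\<And>P. P \<in> \<D>' \<Longrightarrow> oscillating \<epsilon> \<inter> interior P \<subseteq> U P \<and> U P \<in> lmeasurable \<and> measure lebesgue (U P) \<le> m P"
      by metis
    define N where "N = (\<Union>P\<in>\<D>'. P - interior P)"
    have N: "negligible N"
      unfolding N_def
    proof (intro negligible_Union finite_imageI fin; clarsimp)
      fix P assume "P \<in> \<D>'"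
      then obtain c d where "P = {c..d}"
        using division_ofD(4)[OF D'(2)] by fastforce
      then show "negligible (P - interior P)"
        by (intro negligible_subset[of "{c,d}" "P - interior P"]) auto
    qed
    show ?thesis
    proof (intro exI conjI)
      show "oscillating \<epsilon> \<inter> {u..v} \<subseteq> (\<Union>P\<in>\<D>'. U P) \<union> N"
      proof
        fix t assume t: "t \<in> oscillating \<epsilon> \<inter> {u..v}"
        then obtain P where "P \<in> \<D>'" "t \<in> P"
          using division_ofD(6)[OF D'(2)] by blast
        then show "t \<in> (\<Union>P\<in>\<D>'. U P) \<union> N"
          using t U[of P] by (cases "t \<in> interior P") (auto simp: N_def)
      qed
      have UU: "(\<Union>P\<in>\<D>'. U P) \<in> lmeasurable"
        using U fin by (intro fmeasurable.finite_UN) auto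
      then show "(\<Union>P\<in>\<D>'. U P) \<union> N \<in> lmeasurable"
        using N negligible_imp_measurable by blast
      have "measure lebesgue ((\<Union>P\<in>\<D>'. U P) \<union> N) \<le> measure lebesgue (\<Union>P\<in>\<D>'. U P) + measure lebesgue N"
        using UU N by (intro measure_Un_le) (auto dest: negligible_imp_measurable)
      also have "measure lebesgue N = 0"
        using N negligible_imp_measure0 by blast
      also have "measure lebesgue (\<Union>P\<in>\<D>'. U P) \<le> (\<Sum>P\<in>\<D>'. measure lebesgue (U P))"
        using U fin by (intro measure_UNION_le) (auto dest: fmeasurableD)
      also have "\<dots> \<le> (\<Sum>P\<in>\<D>'. m P)"
        using U by (intro sum_mono) auto
      also have "\<dots> = ((\<Sum>P\<in>\<D>'. total_var F P) - var_sum F \<D>') / (2 * \<epsilon>)"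
        by (simp add: m_def var_sum_def sum_subtractf sum_divide_distrib[symmetric])
      also have "\<dots> \<le> (total_var F {u..v} - var_sum F \<D>') / (2 * \<epsilon>)"
        using total_var_superadditive[of \<D>'] D'(2) \<epsilon> 
        by (intro divide_right_mono) (auto simp: partial_divisions_def)
      also have "\<dots> \<le> e"
        using near \<epsilon> by (simp add: field_simps)
      finally show "measure lebesgue ((\<Union>P\<in>\<D>'. U P) \<union> N) \<le> e" 
        by simp
    qed
  next
    case False
    then show ?thesis
      using e by (intro exI[of _ "{}"]) auto
  qed
  then show ?thesis
    unfolding negligible_outer_le by blast
qed

definition steep :: "real set" where
  "steep = {t. \<forall>R. \<forall>\<delta>>0. \<exists>c d. c < d \<and> t \<in> {c..d} \<and> d - c < \<delta> \<and> R * (d - c) \<le> \<bar>F d - F c\<bar>}"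

lemma steepD:
  assumes "t \<in> steep" "\<delta> > 0"
  shows "\<exists>c d. c < d \<and> t \<in> {c..d} \<and> d - c < \<delta> \<and> R * (d - c) \<le> \<bar>F d - F c\<bar>"
  using assms unfolding steep_def by blast

text \<open>Non-overlapping intervals of slope at least \<open>R\<close> have total length at most the variation divided by
\<open>R\<close>.\<close>

lemma negligible_steep: "negligible (steep \<inter> {u<..<v})"
proof -
  have "\<exists>T. steep \<inter> {u<..<v} \<subseteq> T \<and> T \<in> lmeasurable \<and> measure lebesgue T \<le> e" if e: "e > 0" for e
  proof -
    define R where "R = (\<bar>B\<bar> + 1) / e"
    have R: "R > 0"
      using e by (simp add: R_def)
    obtain U where "steep \<inter> {u<..<v} \<subseteq> U" "U \<in> lmeasurable" "measure lebesgue U \<le> e"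
    proof (rule Vitali_interval_cover[of "steep \<inter> {u<..<v}" "{u..v}"
            "\<lambda>c d. R * (d - c) \<le> \<bar>F d - F c\<bar>" e])
      fix t \<delta> :: real assume t: "t \<in> steep \<inter> {u<..<v}" and \<delta>: "\<delta> > 0"
      define \<delta>' where "\<delta>' = min \<delta> (min (t - u) (v - t))"
      have "\<delta>' > 0"
        using t \<delta> by (auto simp: \<delta>'_def)
      then obtain c d where "c < d" "t \<in> {c..d}" "d - c < \<delta>'" "R * (d - c) \<le> \<bar>F d - F c\<bar>"
        using steepD[of t \<delta>' R] t by blast
      then show "\<exists>c d. c < d \<and> t \<in> {c..d} \<and> {c..d} \<subseteq> {u..v} \<and> d - c < \<delta> \<and> R * (d - c) \<le> \<bar>F d - F c\<bar>"
        by (intro exI[of _ c] exI[of _ d]) (auto simp: \<delta>'_def)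
    next
      fix \<K> assume K: "\<K> \<in> partial_divisions {u..v}"
        "\<And>K. K \<in> \<K> \<Longrightarrow> \<exists>c d. K = {c..d} \<and> c < d \<and> R * (d - c) \<le> \<bar>F d - F c\<bar>"
      have "R * (\<Sum>K\<in>\<K>. Sup K - Inf K) \<le> var_sum F \<K>"
        unfolding var_sum_def sum_distrib_left using K(2) by (intro sum_mono) fastforce
      also have "\<dots> \<le> \<bar>B\<bar> + 1"
        using bv[OF K(1)] by linarith
      also have "\<dots> = R * e"
        using e by (simp add: R_def)
      finally show "(\<Sum>K\<in>\<K>. Sup K - Inf K) \<le> e"
        using R by simp
    qed blast
    then show ?thesis
      by blast
  qed
  then show ?thesis
    unfolding negligible_outer_le by blast
qed

end

text \<open>A bounded quantity converges unless it oscillates about some rational level; the limit is the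
supremum of its eventual lower bounds.\<close>

lemma tendsto_of_dichotomy:
  fixes q :: "'a \<Rightarrow> real"
  assumes Fbot: "F \<noteq> bot"
    and bound: "eventually (\<lambda>h. \<bar>q h\<bar> \<le> R) F"
    and dich: "\<And>m \<epsilon>. m \<in> \<rat> \<Longrightarrow> \<epsilon> > 0 \<Longrightarrow>
        eventually (\<lambda>h. q h \<ge> m - \<epsilon>) F \<or> eventually (\<lambda>h. q h \<le> m + \<epsilon>) F"
  obtains L where "(q \<longlongrightarrow> L) F"
proof -
  define A where "A = {r. eventually (\<lambda>h. q h \<ge> r) F}"
  have ne: "A \<noteq> {}"
    using bound by (auto simp: A_def elim!: eventually_mono intro!: exI[of _ "-R"])
  have le: "r \<le> R" if "r \<in> A" for r
  proof -
    have "eventually (\<lambda>h. r \<le> R) F"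
      using bound that unfolding A_def mem_Collect_eq by eventually_elim linarith
    with Fbot show ?thesis
      by simp
  qed
  then have bdd: "bdd_above A"
    by (auto simp: bdd_above_def)
  define L where "L = Sup A"
  have "(q \<longlongrightarrow> L) F"
    unfolding tendsto_iff
  proof (intro allI impI)
    fix e :: real assume e: "e > 0"
    obtain r where "r \<in> A" "r > L - e"
      using less_cSupD[OF ne, of "L - e"] e by (auto simp: L_def)
    then have 1: "eventually (\<lambda>h. q h > L - e) F"
      unfolding A_def mem_Collect_eq by (auto elim!: eventually_mono)
    obtain m where m: "m \<in> \<rat>" "L + e/4 < m" "m < L + e/2"
      using Rats_dense_in_real[of "L + e/4" "L + e/2"] e by auto
    have "m - e/4 \<notin> A"
      using cSup_upper[OF _ bdd, of "m - e/4"] m by (auto simp: L_def)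
    then have "eventually (\<lambda>h. q h \<le> m + e/4) F"
      using dich[OF m(1), of "e/4"] e by (auto simp: A_def)
    with 1 show "eventually (\<lambda>h. dist (q h) L < e) F"
      by eventually_elim (use m e in \<open>auto simp: dist_real_def\<close>)
  qed
  with that show ?thesis .
qed

text \<open>Subtracting a linear function of slope \<open>m\<close> turns oscillation of the difference quotient about the
level \<open>m\<close> into oscillation about \<open>0\<close>.\<close>

lemma (in bounded_var) bounded_var_affine:
  "bounded_var (\<lambda>t. F t - m * t) u v (B + \<bar>m\<bar> * \<bar>v - u\<bar>)"
proof
  fix \<D> assume D: "\<D> \<in> partial_divisions {u..v}"
  then have div: "\<D> division_of \<Union>\<D>" "\<Union>\<D> \<subseteq> {u..v}"
    by (auto simp: partial_divisions_def)
  have "(\<Sum>K\<in>\<D>. Sup K - Inf K) = sum (measure lborel) \<D>"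
  proof (rule sum.cong)
    show "Sup K - Inf K = measure lborel K" if "K \<in> \<D>" for K
      using division_ofD(3,4)[OF div(1) that] by fastforce
  qed auto
  also have "\<dots> \<le> measure lborel {u..v}"
    using subadditive_content_division[OF div(1), of u v] div(2) by simp
  also have "\<dots> \<le> \<bar>v - u\<bar>"
    by simp
  finally have len: "(\<Sum>K\<in>\<D>. Sup K - Inf K) \<le> \<bar>v - u\<bar>" .
  have "var_sum (\<lambda>t. F t - m * t) \<D> \<le> (\<Sum>K\<in>\<D>. \<bar>F (Sup K) - F (Inf K)\<bar> + \<bar>m\<bar> * (Sup K - Inf K))"
    unfolding var_sum_def
  proof (rule sum_mono)
    fix K assume "K \<in> \<D>"
    then obtain c d where "K = {c..d}" "c \<le> d"
      using division_ofD(3,4)[OF div(1), of K] by fastforce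
    moreover have "\<bar>m * (d - c)\<bar> = \<bar>m\<bar> * (d - c)" if "c \<le> d"
      using that by (simp add: abs_mult)
    ultimately show "\<bar>F (Sup K) - m * Sup K - (F (Inf K) - m * Inf K)\<bar>
        \<le> \<bar>F (Sup K) - F (Inf K)\<bar> + \<bar>m\<bar> * (Sup K - Inf K)"
      by (simp add: right_diff_distrib) 
  qed
  also have "\<dots> \<le> B + \<bar>m\<bar> * \<bar>v - u\<bar>"
    unfolding sum.distrib sum_distrib_left[symmetric]
    using bv[OF D] mult_left_mono[OF len, of "\<bar>m\<bar>"] by (simp add: var_sum_def)
  finally show "var_sum (\<lambda>t. F t - m * t) \<D> \<le> B + \<bar>m\<bar> * \<bar>v - u\<bar>" .
qed

text \<open>The difference quotient \<open>q\<close> is bounded because \<open>t\<close> is not steep, and satisfies the dichotomy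
of \<open>tendsto_of_dichotomy\<close> because \<open>t\<close> is not oscillating for the tilted functions. Rational slopes
and tolerances \<open>1/(n+1)\<close> suffice, so only countably many exceptional sets arise.\<close>

lemma has_real_derivative_if_not_oscillating:
  fixes F :: "real \<Rightarrow> real"
  assumes st: "t \<notin> bounded_var.steep F"
    and os: "\<And>m n. m \<in> \<rat> \<Longrightarrow> t \<notin> bounded_var.oscillating (\<lambda>t. F t - m * t) (1 / Suc n)"
    and bvF: "bounded_var F u v B"
  obtains L where "(F has_real_derivative L) (at t)"
proof -
  interpret bounded_var F u v B by fact
  define q where "q h = (F (t + h) - F t) / h" for h
  have ev: "eventually (\<lambda>h. P (F (max t (t+h)) - F (min t (t+h))) \<bar>h\<bar>) (at (0::real))"
    if "\<delta> > 0" and P: "\<And>c d. c < d \<Longrightarrow> t \<in> {c..d} \<Longrightarrow> d - c < \<delta> \<Longrightarrow> P (F d - F c) (d - c)" for P \<delta>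
  proof -
    have "P (F (max t (t+h)) - F (min t (t+h))) \<bar>h\<bar>" if "h \<noteq> 0" "\<bar>h\<bar> < \<delta>" for h
      using P[of "min t (t+h)" "max t (t+h)"] that
      by (cases "h > 0") (auto simp: min_def max_def abs_if)
    then show ?thesis
      unfolding eventually_at using \<open>\<delta> > 0\<close> by (auto simp: dist_real_def)
  qed
  have qeq: "F (max t (t+h)) - F (min t (t+h)) = q h * \<bar>h\<bar>" if "h \<noteq> 0" for h
    using that by (cases "h > 0") (auto simp: q_def min_def max_def field_simps)
  have "\<exists>R \<delta>. \<delta> > 0 \<and> (\<forall>c d. c < d \<longrightarrow> t \<in> {c..d} \<longrightarrow> d - c < \<delta> \<longrightarrow> \<bar>F d - F c\<bar> \<le> R * (d - c))"
    using st unfolding steep_def mem_Collect_eq by (meson linear)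
  then obtain R \<delta> where "\<delta> > 0"
    and R: "\<And>c d. c < d \<Longrightarrow> t \<in> {c..d} \<Longrightarrow> d - c < \<delta> \<Longrightarrow> \<bar>F d - F c\<bar> \<le> R * (d - c)"
    by blast
  have bound: "eventually (\<lambda>h. \<bar>q h\<bar> \<le> R) (at 0)"
  proof -
    have "eventually (\<lambda>h. \<bar>F (max t (t+h)) - F (min t (t+h))\<bar> \<le> R * \<bar>h\<bar>) (at 0)"
      using ev[OF \<open>\<delta> > 0\<close>, of "\<lambda>x y. \<bar>x\<bar> \<le> R * y"] R by auto
    moreover have "eventually (\<lambda>h::real. h \<noteq> 0) (at 0)"
      by (simp add: eventually_at_filter)
    ultimately show ?thesis
      by eventually_elim (simp add: qeq abs_mult)
  qed
  have dich: "eventually (\<lambda>h. q h \<ge> m - \<epsilon>) (at 0) \<or> eventually (\<lambda>h. q h \<le> m + \<epsilon>) (at 0)"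
    if "m \<in> \<rat>" "\<epsilon> > 0" for m \<epsilon>
  proof -
    obtain n where n: "1 / Suc n < \<epsilon>"
      using \<open>\<epsilon> > 0\<close> nat_approx_posE by blast
    let ?e = "1 / Suc n"
    interpret G: bounded_var "\<lambda>t. F t - m * t" u v "B + \<bar>m\<bar> * \<bar>v - u\<bar>"
      by (rule bounded_var_affine)
    have "\<exists>\<delta>>0. \<exists>s. (s = 1 \<or> s = -1) \<and> (\<forall>c d. c < d \<longrightarrow> t \<in> {c..d} \<longrightarrow> d - c < \<delta> \<longrightarrow>
           \<not> s * ((F d - m * d) - (F c - m * c)) \<le> - ?e * (d - c))"
      using os[OF \<open>m \<in> \<rat>\<close>, of n] unfolding G.oscillating_def mem_Collect_eq ball_simps by blast
    then obtain \<delta> s where "\<delta> > 0" and s: "s = 1 \<or> s = -1"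
      and os': "\<And>c d. c < d \<Longrightarrow> t \<in> {c..d} \<Longrightarrow> d - c < \<delta> \<Longrightarrow>
           \<not> s * ((F d - m * d) - (F c - m * c)) \<le> - ?e * (d - c)"
      by blast
    have aff: "s * (F d - F c - m * (d - c)) \<ge> - ?e * (d - c)"
      if "c < d" "t \<in> {c..d}" "d - c < \<delta>" for c d
    proof -
      have "F d - F c - m * (d - c) = (F d - m * d) - (F c - m * c)"
        by (simp add: algebra_simps)
      with os'[OF that] show ?thesis
        by (metis linear)
    qed
    have "eventually (\<lambda>h. s * (F (max t (t+h)) - F (min t (t+h)) - m * \<bar>h\<bar>) \<ge> - ?e * \<bar>h\<bar>) (at 0)"
      using ev[OF \<open>\<delta> > 0\<close>, of "\<lambda>x y. s * (x - m * y) \<ge> - ?e * y", OF aff] .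
    moreover have "eventually (\<lambda>h::real. h \<noteq> 0) (at 0)"
      by (simp add: eventually_at_filter)
    ultimately have *: "eventually (\<lambda>h. s * (q h - m) \<ge> - ?e) (at 0)"
    proof eventually_elim
      case (elim h)
      have "- ?e * \<bar>h\<bar> \<le> s * (q h * \<bar>h\<bar> - m * \<bar>h\<bar>)"
        using elim(1) unfolding qeq[OF elim(2)] .
      also have "\<dots> = s * (q h - m) * \<bar>h\<bar>"
        by (simp add: algebra_simps)
      finally have "- ?e * \<bar>h\<bar> \<le> s * (q h - m) * \<bar>h\<bar>" .
      with elim(2) show ?case
        by (metis mult_le_cancel_right_pos zero_less_abs_iff)
    qed
    from s show ?thesis
    proof
      assume "s = 1"
      with * n show ?thesis
        by (intro disjI1) (auto elim!: eventually_mono)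
    next
      assume "s = -1"
      with * n show ?thesis
        by (intro disjI2) (auto elim!: eventually_mono)
    qed
  qed
  obtain L where "(q \<longlongrightarrow> L) (at 0)"
    using tendsto_of_dichotomy[OF _ bound dich] by auto
  then have "(F has_real_derivative L) (at t)"
    by (simp add: DERIV_def q_def[abs_def])
  with that show ?thesis .
qed

theorem (in bounded_var) negligible_not_differentiable:
  "negligible {t \<in> {u<..<v}. \<nexists>L. (F has_real_derivative L) (at t)}"
proof -
  let ?O = "\<lambda>(m::real, n::nat). bounded_var.oscillating (\<lambda>t. F t - m * t) (1 / Suc n) \<inter> {u..v}"
  have "negligible (\<Union>x\<in>\<rat>\<times>UNIV. ?O x)"
  proof (rule negligible_countable_Union)
    show "countable (?O ` (\<rat>\<times>UNIV))"
      by (intro countable_image countable_SIGMA) (auto simp: countable_rat)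
    show "negligible X" if "X \<in> ?O ` (\<rat>\<times>UNIV)" for X
    proof -
      obtain m n where X: "X = ?O (m, n)"
        using \<open>X \<in> ?O ` (\<rat>\<times>UNIV)\<close> by auto
      interpret G: bounded_var "\<lambda>t. F t - m * t" u v "B + \<bar>m\<bar> * \<bar>v - u\<bar>"
        by (rule bounded_var_affine)
      show ?thesis
        unfolding X using G.negligible_oscillating by simp
    qed
  qed
  then have N: "negligible ((\<Union>x\<in>\<rat>\<times>UNIV. ?O x) \<union> (steep \<inter> {u<..<v}))"
    using negligible_steep by simp
  show ?thesis
  proof (rule negligible_subset[OF N], rule subsetI, rule ccontr)
    fix t assume "t \<in> {t \<in> {u<..<v}. \<nexists>L. (F has_real_derivative L) (at t)}"
      and nin: "t \<notin> (\<Union>x\<in>\<rat>\<times>UNIV. ?O x) \<union> (steep \<inter> {u<..<v})"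
    then have t: "t \<in> {u<..<v}" "\<nexists>L. (F has_real_derivative L) (at t)" "t \<notin> steep"
      by auto
    then obtain m n where "m \<in> \<rat>" "t \<in> bounded_var.oscillating (\<lambda>t. F t - m * t) (1 / Suc n)"
      using has_real_derivative_if_not_oscillating[OF t(3) _ bounded_var_axioms] by metis
    then show False
      using t(1) nin by force
  qed
qed

section \<open>Absolutely continuous functions\<close>

lemma division_cases:
  fixes \<D> :: "real set set"
  assumes "\<D> division_of S" "K \<in> \<D>"
  obtains c d where "K = {c..d}" "c \<le> d" "{c..d} \<subseteq> S"
  using division_ofD(2,3,4)[OF assms] by fastforce

lemma abs_continuous_onD:
  assumes "abs_continuous_on S F" "\<epsilon> > 0"
  obtains \<delta> where "\<delta> > 0" "\<And>\<D>. \<D> \<in> partial_divisions S \<Longrightarrow> (\<Sum>K\<in>\<D>. Sup K - Inf K) < \<delta> \<Longrightarrow>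
     (\<Sum>K\<in>\<D>. cmod (F (Sup K) - F (Inf K))) < \<epsilon>"
proof -
  obtain \<delta> where "\<delta> > 0" "\<forall>\<D>. \<D> division_of \<Union>\<D> \<longrightarrow> \<Union>\<D> \<subseteq> S \<longrightarrow>
        (\<Sum>K\<in>\<D>. Sup K - Inf K) < \<delta> \<longrightarrow> (\<Sum>K\<in>\<D>. cmod (F (Sup K) - F (Inf K))) < \<epsilon>"
    using assms unfolding abs_continuous_on_def by blast
  then show ?thesis
    by (intro that[of \<delta>]) (auto simp: partial_divisions_def)
qed

lemma abs_continuous_onI:
  assumes "\<And>\<epsilon>. \<epsilon> > 0 \<Longrightarrow> \<exists>\<delta>>0. \<forall>\<D>. \<D> \<in> partial_divisions S \<longrightarrow> (\<Sum>K\<in>\<D>. Sup K - Inf K) < \<delta> \<longrightarrow>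
     (\<Sum>K\<in>\<D>. cmod (F (Sup K) - F (Inf K))) < \<epsilon>"
  shows "abs_continuous_on S F"
  using assms unfolding abs_continuous_on_def partial_divisions_def by (simp add: imp_conjL)

lemma abs_continuous_on_imp_continuous_on:
  assumes "abs_continuous_on {u..v} F"
  shows "continuous_on {u..v} F"
  unfolding continuous_on_iff
proof (intro ballI allI impI)
  fix s \<epsilon> :: real assume s: "s \<in> {u..v}" and "\<epsilon> > 0"
  then obtain \<delta> where \<delta>: "\<delta> > 0" "\<And>\<D>. \<D> \<in> partial_divisions {u..v} \<Longrightarrow> (\<Sum>K\<in>\<D>. Sup K - Inf K) < \<delta> \<Longrightarrow>
     (\<Sum>K\<in>\<D>. cmod (F (Sup K) - F (Inf K))) < \<epsilon>"
    using abs_continuous_onD[OF assms] by blast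
  have "dist (F t) (F s) < \<epsilon>" if t: "t \<in> {u..v}" "dist t s < \<delta>" for t
  proof -
    have le: "min s t \<le> max s t"
      by auto
    have "{{min s t..max s t}} division_of \<Union>{{min s t..max s t}}"
      using division_of_self[of "min s t" "max s t"] le by (metis Union_empty Union_insert Un_empty_right atLeastatMost_empty_iff box_real(2) not_less)
    then have "cmod (F (max s t) - F (min s t)) < \<epsilon>"
      using \<delta>(2)[of "{{min s t..max s t}}"] s t le by (auto simp: partial_divisions_def dist_real_def)
    then show ?thesis
      by (cases "s \<le> t") (auto simp: dist_norm norm_minus_commute)
  qed
  with \<delta>(1) show "\<exists>d>0. \<forall>x'\<in>{u..v}. dist x' s < d \<longrightarrow> dist (F x') (F s) < \<epsilon>"
    by blast
qed

text \<open>Sums and products inherit absolute continuity because their increments are controlled by those of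
the two functions.\<close>

lemma abs_continuous_on_dominated:
  assumes F: "abs_continuous_on S F" and G: "abs_continuous_on S G"
    and H: "\<And>s t. s \<in> S \<Longrightarrow> t \<in> S \<Longrightarrow> cmod (H t - H s) \<le> C * (cmod (F t - F s) + cmod (G t - G s))"
  shows "abs_continuous_on S H"
proof (rule abs_continuous_onI)
  fix \<epsilon> :: real assume "\<epsilon> > 0"
  define A where "A = \<bar>C\<bar> + 1"
  define \<eta> where "\<eta> = \<epsilon> / (2 * A)"
  have A: "C \<le> A" "A > 0"
    by (auto simp: A_def)
  have \<eta>: "\<eta> > 0"
    using \<open>\<epsilon> > 0\<close> A by (simp add: \<eta>_def)
  obtain \<delta>1 where \<delta>1: "\<delta>1 > 0" "\<And>\<D>. \<D> \<in> partial_divisions S \<Longrightarrow> (\<Sum>K\<in>\<D>. Sup K - Inf K) < \<delta>1 \<Longrightarrow>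
     (\<Sum>K\<in>\<D>. cmod (F (Sup K) - F (Inf K))) < \<eta>"
    using abs_continuous_onD[OF F \<eta>] by blast
  obtain \<delta>2 where \<delta>2: "\<delta>2 > 0" "\<And>\<D>. \<D> \<in> partial_divisions S \<Longrightarrow> (\<Sum>K\<in>\<D>. Sup K - Inf K) < \<delta>2 \<Longrightarrow>
     (\<Sum>K\<in>\<D>. cmod (G (Sup K) - G (Inf K))) < \<eta>"
    using abs_continuous_onD[OF G \<eta>] by blast
  have "(\<Sum>K\<in>\<D>. cmod (H (Sup K) - H (Inf K))) < \<epsilon>"
    if D: "\<D> \<in> partial_divisions S" and len: "(\<Sum>K\<in>\<D>. Sup K - Inf K) < min \<delta>1 \<delta>2" for \<D>
  proof -
    have "(\<Sum>K\<in>\<D>. cmod (H (Sup K) - H (Inf K))) \<le>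
        (\<Sum>K\<in>\<D>. A * (cmod (F (Sup K) - F (Inf K)) + cmod (G (Sup K) - G (Inf K))))"
    proof (rule sum_mono)
      fix K assume K: "K \<in> \<D>"
      have "\<D> division_of \<Union>\<D>" "\<Union>\<D> \<subseteq> S"
        using D by (auto simp: partial_divisions_def)
      then obtain c d where cd: "K = {c..d}" "c \<le> d" "{c..d} \<subseteq> S"
        using division_cases[OF _ K] by (metis subset_trans)
      then have "cmod (H d - H c) \<le> C * (cmod (F d - F c) + cmod (G d - G c))"
        by (intro H) auto
      also have "\<dots> \<le> A * (cmod (F d - F c) + cmod (G d - G c))"
        using A by (intro mult_right_mono) auto
      finally show "cmod (H (Sup K) - H (Inf K)) \<le>
          A * (cmod (F (Sup K) - F (Inf K)) + cmod (G (Sup K) - G (Inf K)))"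
        using cd by simp
    qed
    also have "\<dots> = A * ((\<Sum>K\<in>\<D>. cmod (F (Sup K) - F (Inf K))) + (\<Sum>K\<in>\<D>. cmod (G (Sup K) - G (Inf K))))"
      by (simp add: sum_distrib_left[symmetric] sum.distrib)
    also have "\<dots> < A * (\<eta> + \<eta>)"
      using \<delta>1(2)[OF D] \<delta>2(2)[OF D] len A by (intro mult_strict_left_mono add_strict_mono) auto
    also have "\<dots> = \<epsilon>"
      using A by (simp add: \<eta>_def)
    finally show ?thesis .
  qed
  with \<delta>1(1) \<delta>2(1) show "\<exists>\<delta>>0. \<forall>\<D>. \<D> \<in> partial_divisions S \<longrightarrow> (\<Sum>K\<in>\<D>. Sup K - Inf K) < \<delta> \<longrightarrow>
     (\<Sum>K\<in>\<D>. cmod (H (Sup K) - H (Inf K))) < \<epsilon>"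
    by (intro exI[of _ "min \<delta>1 \<delta>2"]) auto
qed

lemma abs_continuous_on_diff:
  assumes "abs_continuous_on S F" "abs_continuous_on S G"
  shows "abs_continuous_on S (\<lambda>t. F t - G t)"
proof (rule abs_continuous_on_dominated[OF assms, of _ 1])
  fix s t
  have "F t - G t - (F s - G s) = (F t - F s) - (G t - G s)"
    by simp
  then show "cmod (F t - G t - (F s - G s)) \<le> 1 * (cmod (F t - F s) + cmod (G t - G s))"
    using norm_triangle_ineq4[of "F t - F s" "G t - G s"] by (simp only: mult_1)
qed

lemma abs_continuous_on_mult:
  assumes F: "abs_continuous_on {u..v} F" and G: "abs_continuous_on {u..v} G"
  shows "abs_continuous_on {u..v} (\<lambda>t. F t * G t)"
proof -
  have "compact (F ` {u..v})" "compact (G ` {u..v})"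
    using F G by (auto intro!: compact_continuous_image abs_continuous_on_imp_continuous_on)
  then have "bounded (F ` {u..v})" "bounded (G ` {u..v})"
    using compact_imp_bounded by auto
  then obtain A B where A: "\<And>t. t \<in> {u..v} \<Longrightarrow> cmod (F t) \<le> A" and B: "\<And>t. t \<in> {u..v} \<Longrightarrow> cmod (G t) \<le> B"
    unfolding bounded_iff by fastforce
  show ?thesis
  proof (rule abs_continuous_on_dominated[OF F G, of _ "max A B"])
    fix s t assume st: "s \<in> {u..v}" "t \<in> {u..v}"
    have "F t * G t - F s * G s = (F t - F s) * G t + F s * (G t - G s)"
      by (simp add: algebra_simps)
    then have "cmod (F t * G t - F s * G s) \<le> cmod (F t - F s) * cmod (G t) + cmod (F s) * cmod (G t - G s)"
      by (metis norm_mult norm_triangle_ineq)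
    also have "\<dots> \<le> cmod (F t - F s) * max A B + max A B * cmod (G t - G s)"
      using A[OF st(1)] B[OF st(2)] by (intro add_mono mult_left_mono mult_right_mono) auto
    finally show "cmod (F t * G t - F s * G s) \<le> max A B * (cmod (F t - F s) + cmod (G t - G s))"
      by (simp add: algebra_simps)
  qed
qed

lemma sum_length_partial_division_le:
  assumes "\<D> \<in> partial_divisions S" "S \<in> lmeasurable"
  shows "(\<Sum>K\<in>\<D>. Sup K - Inf K) \<le> measure lebesgue S"
proof -
  have div: "\<D> division_of \<Union>\<D>" "\<Union>\<D> \<subseteq> S"
    using assms by (auto simp: partial_divisions_def)
  have "(\<Sum>K\<in>\<D>. Sup K - Inf K) = sum (measure lebesgue) \<D>"
  proof (rule sum.cong)
    show "Sup K - Inf K = measure lebesgue K" if "K \<in> \<D>" for K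
      using division_cases[OF div(1) that] by fastforce
  qed auto
  also have "\<dots> = measure lebesgue (\<Union>\<D>)"
    using content_division[OF div(1)] by simp
  also have "\<dots> \<le> measure lebesgue S"
    using div assms(2) lmeasurable_division[OF div(1)] by (intro measure_mono_fmeasurable) (auto dest: fmeasurableD)
  finally show ?thesis .
qed

text \<open>On intervals shorter than the \<open>\<delta>\<close> that belongs to \<open>\<epsilon> = 1\<close>, the variation is at most \<open>1\<close>. Countably
many such intervals with rational endpoints cover the interior.\<close>

theorem abs_continuous_negligible_not_differentiable:
  assumes F: "abs_continuous_on {c..d} F"
  shows "negligible {t \<in> {c<..<d}. \<not> F differentiable (at t)}"
proof -
  obtain \<delta> where \<delta>: "\<delta> > 0" "\<And>\<D>. \<D> \<in> partial_divisions {c..d} \<Longrightarrow> (\<Sum>K\<in>\<D>. Sup K - Inf K) < \<delta> \<Longrightarrow>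
     (\<Sum>K\<in>\<D>. cmod (F (Sup K) - F (Inf K))) < 1"
    using abs_continuous_onD[OF F zero_less_one] by blast
  define J where "J = {(u,v). u \<in> \<rat> \<and> v \<in> \<rat> \<and> {u..v} \<subseteq> {c..d} \<and> v - u < \<delta> \<and> u \<le> v}"
  define bad where "bad = (\<lambda>(u,v). {t \<in> {u<..<v}. \<nexists>L. ((\<lambda>t. Re (F t)) has_real_derivative L) (at t)} \<union>
       {t \<in> {u<..<v}. \<nexists>L. ((\<lambda>t. Im (F t)) has_real_derivative L) (at t)})"
  have neg: "negligible (\<Union>(bad ` J))"
  proof (rule negligible_countable_Union)
    have "J \<subseteq> \<rat> \<times> \<rat>"
      by (auto simp: J_def)
    then show "countable (bad ` J)"
      using countable_rat by (meson countable_SIGMA countable_image countable_subset)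
    show "negligible X" if "X \<in> bad ` J" for X
    proof -
      from that have "\<exists>i. i \<in> J \<and> X = bad i"
        unfolding image_def by blast
      then obtain u v where uv: "(u,v) \<in> J" "X = bad (u,v)"
        by (metis surj_pair)
      have J: "u \<le> v" "{u..v} \<subseteq> {c..d}" "v - u < \<delta>"
        using uv(1) unfolding J_def by blast+
      have *: "var_sum g \<D> \<le> 1"
        if D: "\<D> \<in> partial_divisions {u..v}" and g: "\<And>s t. \<bar>g t - g s\<bar> \<le> cmod (F t - F s)" for g \<D>
      proof -
        have "(\<Sum>K\<in>\<D>. Sup K - Inf K) \<le> v - u"
          using sum_length_partial_division_le[OF D] J(1) by simp
        then have "(\<Sum>K\<in>\<D>. cmod (F (Sup K) - F (Inf K))) < 1"
          using J(2,3) D by (intro \<delta>(2)) (auto simp: partial_divisions_def)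
        moreover have "var_sum g \<D> \<le> (\<Sum>K\<in>\<D>. cmod (F (Sup K) - F (Inf K)))"
          unfolding var_sum_def by (intro sum_mono g)
        ultimately show ?thesis
          by simp
      qed
      interpret R: bounded_var "\<lambda>t. Re (F t)" u v 1
      proof (standard, rule *)
        show "\<bar>Re (F t) - Re (F s)\<bar> \<le> cmod (F t - F s)" for s t
          using abs_Re_le_cmod[of "F t - F s"] by simp
      qed
      interpret I: bounded_var "\<lambda>t. Im (F t)" u v 1
      proof (standard, rule *)
        show "\<bar>Im (F t) - Im (F s)\<bar> \<le> cmod (F t - F s)" for s t
          using abs_Im_le_cmod[of "F t - F s"] by simp
      qed
      show ?thesis
        using R.negligible_not_differentiable I.negligible_not_differentiable 
        by (simp add: uv bad_def)
    qed
  qed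
  show ?thesis
  proof (rule negligible_subset[OF neg], rule subsetI)
    fix t assume "t \<in> {t \<in> {c<..<d}. \<not> F differentiable (at t)}"
    then have t: "c < t" "t < d" "\<not> F differentiable (at t)"
      by auto
    obtain u where u: "u \<in> \<rat>" "max c (t - \<delta>/2) < u" "u < t"
      using Rats_dense_in_real[of "max c (t - \<delta>/2)" t] t \<delta>(1) by auto
    obtain v where v: "v \<in> \<rat>" "t < v" "v < min d (t + \<delta>/2)"
      using Rats_dense_in_real[of t "min d (t + \<delta>/2)"] t \<delta>(1) by auto
    have "(u,v) \<in> J"
      using u v by (auto simp: J_def)
    moreover have "t \<in> bad (u,v)"
    proof (rule ccontr)
      assume "t \<notin> bad (u,v)"
      then obtain L L' where "((\<lambda>t. Re (F t)) has_real_derivative L) (at t)" 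
          "((\<lambda>t. Im (F t)) has_real_derivative L') (at t)"
        using u v by (auto simp: bad_def)
      then have "(F has_vector_derivative Complex L L') (at t)"
        by (simp add: has_vector_derivative_complex_iff)
      with t show False
        using differentiableI_vector by blast
    qed
    ultimately show "t \<in> \<Union>(bad ` J)"
      by blast
  qed
qed

text \<open>The fundamental theorem of calculus, directly from Riemann sums: no integrability of \<open>g\<close> has to be
known in advance. The gauge makes the increments over intervals tagged outside \<open>N\<close>
match the derivative, and confines those tagged in \<open>N\<close> to an open set of small measure, where
absolute continuity makes the total increment small.\<close>

theorem abs_continuous_has_integral:
  assumes F: "abs_continuous_on {c..d} F" and "c \<le> d" and N: "negligible N"
    and der: "\<And>t. t \<in> {c..d} - N \<Longrightarrow> (F has_vector_derivative g t) (at t)"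
  shows "(g has_integral (F d - F c)) {c..d}"
proof -
  \<comment> \<open>On the null set the integrand may be redefined, so that these tags contribute nothing to the Riemann sum.\<close>
  define g' where "g' t = (if t \<in> N then 0 else g t)" for t
  have "(g' has_integral (F d - F c)) {c..d}"
    unfolding has_integral_real
  proof (intro allI impI)
    fix e :: real assume e: "e > 0"
    define \<eta> where "\<eta> = e / (2 * (d - c + 1))"
    have \<eta>: "\<eta> > 0"
      using e \<open>c \<le> d\<close> by (simp add: \<eta>_def)
    obtain \<delta> where \<delta>: "\<delta> > 0" "\<And>\<D>. \<D> \<in> partial_divisions {c..d} \<Longrightarrow> (\<Sum>K\<in>\<D>. Sup K - Inf K) < \<delta> \<Longrightarrow>
       (\<Sum>K\<in>\<D>. cmod (F (Sup K) - F (Inf K))) < e / 2"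
      using abs_continuous_onD[OF F, of "e/2"] e by auto
    obtain U where U: "open U" "N \<subseteq> U" "U - N \<in> lmeasurable" "emeasure lebesgue (U - N) < ennreal \<delta>"
      using sets_lebesgue_outer_open[OF negligible_imp_sets[OF N] \<delta>(1)] by blast
    have "U = (U - N) \<union> N"
      using U(2) by blast
    then have Um: "U \<in> lmeasurable" 
      using U(3) N by (metis fmeasurable.Un negligible_imp_measurable)
    have "measure lebesgue U \<le> measure lebesgue (U - N) + measure lebesgue N"
      using U(3) N by (subst \<open>U = (U - N) \<union> N\<close>) (intro measure_Un_le, auto dest: negligible_imp_measurable)
    also have "\<dots> < \<delta>"
      using U(3,4) \<delta>(1) negligible_imp_measure0[OF N] by (simp add: emeasure_eq_measure2 ennreal_less_iff)
    finally have Ul: "measure lebesgue U < \<delta>" .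
    have "\<exists>r>0. t \<in> {c..d} - N \<longrightarrow> (\<forall>y. \<bar>y - t\<bar> < r \<longrightarrow> cmod (F y - F t - (y - t) *\<^sub>R g t) \<le> \<eta> * \<bar>y - t\<bar>)" for t
    proof (cases "t \<in> {c..d} - N")
      case True
      then show ?thesis
        using der[OF True] \<eta> unfolding has_vector_derivative_def has_derivative_at_alt by (auto simp: real_norm_def) 
    qed (auto intro: exI[of _ 1])
    then obtain r where r: "\<And>t. r t > 0" "\<And>t y. t \<in> {c..d} - N \<Longrightarrow> \<bar>y - t\<bar> < r t \<Longrightarrow>
        cmod (F y - F t - (y - t) *\<^sub>R g t) \<le> \<eta> * \<bar>y - t\<bar>"
      by metis
    define \<gamma> where "\<gamma> t = (if t \<in> N then U else ball t (r t))" for t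
    have "gauge \<gamma>"
      unfolding gauge_def \<gamma>_def using U(1,2) r(1) by auto
    moreover have "cmod ((\<Sum>(x,k)\<in>p. measure lborel k *\<^sub>R g' x) - (F d - F c)) < e"
      if p: "p tagged_division_of {c..d}" "\<gamma> fine p" for p
    proof -
      have fin: "finite p"
        using p by auto
      define h where "h = (\<lambda>(x::real,k). measure lborel k *\<^sub>R g' x - (F (Sup k) - F (Inf k)))"
      define pN where "pN = {(x,k) \<in> p. x \<in> N}"
      have pN: "pN \<subseteq> p"
        by (auto simp: pN_def)
      have K: "\<exists>u v. k = {u..v} \<and> u \<le> x \<and> x \<le> v \<and> c \<le> u \<and> v \<le> d \<and> k \<subseteq> \<gamma> x" if xk: "(x,k) \<in> p" for x k
      proof -
        obtain u v where "k = {u..v}"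
          using tagged_division_ofD(4)[OF p(1) xk] by auto
        then show ?thesis
          using tagged_division_ofD(2,3)[OF p(1) xk] p(2) xk unfolding fine_def by fastforce
      qed
      have "(\<Sum>(x,k)\<in>p. measure lborel k *\<^sub>R g' x) - (F d - F c) = sum h p"
        unfolding additive_tagged_division_1[OF \<open>c \<le> d\<close> p(1), of F, symmetric] h_def 
        by (simp add: sum_subtractf[symmetric] case_prod_unfold)
      also have "\<dots> = sum h (p - pN) + sum h pN"
        using fin pN by (rule sum.subset_diff[rotated])
      finally have "cmod ((\<Sum>(x,k)\<in>p. measure lborel k *\<^sub>R g' x) - (F d - F c)) \<le> cmod (sum h (p - pN)) + cmod (sum h pN)"
        using norm_triangle_ineq by metis
      also have "cmod (sum h (p - pN)) \<le> (\<Sum>(x,k)\<in>p - pN. \<eta> * measure lborel k)"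
      proof (rule sum_norm_le, clarify)
        fix x k assume xk: "(x,k) \<in> p" "(x,k) \<notin> pN"
        then obtain u v where k: "k = {u..v}" "u \<le> x" "x \<le> v" "c \<le> u" "v \<le> d" "k \<subseteq> \<gamma> x"
          using K by blast
        have x: "x \<in> {c..d} - N"
          using xk k by (auto simp: pN_def)
        have near: "\<bar>u - x\<bar> < r x" "\<bar>v - x\<bar> < r x"
          using subsetD[OF k(6), of u] subsetD[OF k(6), of v] k x
          by (auto simp: \<gamma>_def dist_real_def abs_minus_commute)
        have "h (x,k) = (F u - F x - (u - x) *\<^sub>R g x) - (F v - F x - (v - x) *\<^sub>R g x)"
          using k x by (simp add: h_def g'_def algebra_simps)
        then have "cmod (h (x,k)) \<le> cmod (F u - F x - (u - x) *\<^sub>R g x) + cmod (F v - F x - (v - x) *\<^sub>R g x)"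
          by (metis norm_triangle_ineq4)
        also have "\<dots> \<le> \<eta> * \<bar>u - x\<bar> + \<eta> * \<bar>v - x\<bar>"
          using r(2)[OF x near(1)] r(2)[OF x near(2)] by (rule add_mono)
        also have "\<dots> = \<eta> * measure lborel k"
          using k by (simp add: algebra_simps)
        finally show "cmod (h (x,k)) \<le> \<eta> * measure lborel k" .
      qed
      also have "\<dots> \<le> (\<Sum>(x,k)\<in>p. \<eta> * measure lborel k)"
        using fin \<eta> by (intro sum_mono2) auto
      also have "\<dots> = \<eta> * (d - c)"
        using additive_content_tagged_division[of p c d] p(1) \<open>c \<le> d\<close> 
        by (simp add: sum_distrib_left[symmetric] case_prod_unfold)
      also have "\<dots> \<le> e / 2"
        using e \<open>c \<le> d\<close> by (simp add: \<eta>_def field_simps)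
      also have "cmod (sum h pN) < e / 2"
      proof -
        have tp: "pN tagged_partial_division_of {c..d}"
          using tagged_partial_division_subset[OF _ pN] p(1) unfolding tagged_division_of_def by blast
        then have div: "(snd ` pN) division_of \<Union>(snd ` pN)"
          by (rule partial_division_of_tagged_division)
        have sub: "\<Union>(snd ` pN) \<subseteq> {c..d}" "\<Union>(snd ` pN) \<subseteq> U"
          using K by (fastforce simp: pN_def \<gamma>_def)+
        \<comment> \<open>The value at the empty set is fixed because \<open>Sup\<close> and \<open>Inf\<close> are unspecified there.\<close>
        define \<phi> where "\<phi> k = (if k = {} then 0 else cmod (F (Sup k) - F (Inf k)))" for k
        have "cmod (sum h pN) \<le> (\<Sum>(x,k)\<in>pN. \<phi> k)"
        proof (rule sum_norm_le, clarify)
          fix x k assume xk: "(x,k) \<in> pN"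
          then have "k \<noteq> {}"
            using K pN by force
          with xk show "cmod (h (x,k)) \<le> \<phi> k"
            by (simp add: h_def \<phi>_def pN_def g'_def norm_minus_commute)
        qed
        also have "\<dots> = sum \<phi> (snd ` pN)"
        proof (rule sum.over_tagged_division_lemma[OF tagged_partial_division_of_Union_self[OF tp]])
          show "\<phi> (cbox u v) = 0" if "box u v = {}" for u v
            using that by (cases "u = v") (auto simp: \<phi>_def)
        qed
        also have "\<dots> = (\<Sum>k\<in>snd ` pN. cmod (F (Sup k) - F (Inf k)))"
          using division_ofD(3)[OF div] by (intro sum.cong) (auto simp: \<phi>_def)
        also have "\<dots> < e / 2"
        proof (rule \<delta>(2))
          show "snd ` pN \<in> partial_divisions {c..d}"
            using div sub by (simp add: partial_divisions_def)
          have "snd ` pN \<in> partial_divisions U"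
            using div sub by (simp add: partial_divisions_def)
          from sum_length_partial_division_le[OF this Um] Ul
          show "(\<Sum>K\<in>snd ` pN. Sup K - Inf K) < \<delta>"
            by simp
        qed
        finally show ?thesis .
      qed
      finally show ?thesis
        by simp
    qed
    ultimately show "\<exists>\<gamma>. gauge \<gamma> \<and> (\<forall>\<D>. \<D> tagged_division_of {c..d} \<and> \<gamma> fine \<D> \<longrightarrow>
        cmod ((\<Sum>(x,k)\<in>\<D>. measure lborel k *\<^sub>R g' x) - (F d - F c)) < e)"
      by (intro exI[of _ \<gamma>] conjI allI impI) (assumption, elim conjE)
  qed
  then show ?thesis
    by (rule has_integral_spike[OF N, rotated]) (simp add: g'_def)
qed

text \<open>Splitting \<open>\<bar>q\<bar>\<close> at height \<open>n\<close>: the part \<open>r n\<close> above the height has small integral by dominated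
convergence, and the bounded part contributes at most \<open>n\<close> times the total length.\<close>

lemma abs_continuous_on_indefinite_integral:
  assumes q: "q absolutely_integrable_on {c..d}"
    and F: "\<And>s t. c \<le> s \<Longrightarrow> s \<le> t \<Longrightarrow> t \<le> d \<Longrightarrow> (q has_integral (F t - F s)) {s..t}"
  shows "abs_continuous_on {c..d} F"
proof (rule abs_continuous_onI)
  fix \<epsilon> :: real assume \<epsilon>: "\<epsilon> > 0"
  define r where "r n t = max (cmod (q t) - real n) 0" for n t
  have qn: "(\<lambda>t. cmod (q t)) absolutely_integrable_on {c..d}"
    using q by (rule absolutely_integrable_norm[unfolded o_def])
  have rint: "r n absolutely_integrable_on {c..d}" for n
    unfolding r_def by (intro absolutely_integrable_max_1 set_integral_diff qn) auto
  have "(\<lambda>n. integral {c..d} (r n)) \<longlonglongrightarrow> integral {c..d} (\<lambda>t. 0::real)"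
  proof (rule dominated_convergence)
    show "r n integrable_on {c..d}" for n
      using rint absolutely_integrable_on_def by blast
    show "(\<lambda>t. cmod (q t)) integrable_on {c..d}"
      using qn absolutely_integrable_on_def by blast
    show "norm (r n t) \<le> cmod (q t)" for n t
      by (auto simp: r_def)
    show "(\<lambda>n. r n t) \<longlonglongrightarrow> 0" for t
    proof (rule tendsto_eventually)
      obtain n0 where "cmod (q t) \<le> real n0"
        using real_arch_simple by blast
      then show "eventually (\<lambda>n. r n t = 0) sequentially"
        unfolding r_def by (intro eventually_sequentiallyI[of n0]) (auto simp: max_def)
    qed
  qed
  then have "eventually (\<lambda>n. integral {c..d} (r n) < \<epsilon> / 2) sequentially"
    using \<epsilon> by (intro order_tendstoD(2)[of _ 0]) auto
  then obtain n where n: "integral {c..d} (r n) < \<epsilon> / 2"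
    using eventually_happens sequentially_bot by blast
  define \<delta> where "\<delta> = \<epsilon> / (2 * (real n + 1))"
  have \<delta>: "\<delta> > 0"
    using \<epsilon> by (simp add: \<delta>_def)
  have "(\<Sum>K\<in>\<D>. cmod (F (Sup K) - F (Inf K))) < \<epsilon>"
    if D: "\<D> \<in> partial_divisions {c..d}" and len: "(\<Sum>K\<in>\<D>. Sup K - Inf K) < \<delta>" for \<D>
  proof -
    have div: "\<D> division_of \<Union>\<D>" "\<Union>\<D> \<subseteq> {c..d}"
      using D by (auto simp: partial_divisions_def)
    have rK: "r n integrable_on {s..t}" if "{s..t} \<subseteq> {c..d}" for s t
      using rint[of n] that integrable_on_subinterval unfolding absolutely_integrable_on_def by blast
    have "(\<Sum>K\<in>\<D>. cmod (F (Sup K) - F (Inf K))) \<le> (\<Sum>K\<in>\<D>. real n * (Sup K - Inf K) + integral K (r n))"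
    proof (rule sum_mono)
      fix K assume "K \<in> \<D>"
      then obtain s t where K: "K = {s..t}" "s \<le> t" "{s..t} \<subseteq> {c..d}"
        using division_cases[OF div(1)] div(2) by (metis subset_trans)
      have int: "(q has_integral (F t - F s)) {s..t}"
        using K by (intro F) auto
      have "((\<lambda>\<tau>. real n + r n \<tau>) has_integral (real n * (t - s) + integral {s..t} (r n))) {s..t}"
        using has_integral_const_real[of "real n" s t] K 
        by (intro has_integral_add integrable_integral rK) (auto simp: mult.commute)
      moreover have "cmod (q \<tau>) \<le> real n + r n \<tau>" for \<tau>
        by (simp add: r_def)
      ultimately have "cmod (integral {s..t} q) \<le> integral {s..t} (\<lambda>\<tau>. real n + r n \<tau>)"
        using int by (intro Henstock_Kurzweil_Integration.integral_norm_bound_integral) (auto dest: has_integral_integrable)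
      then show "cmod (F (Sup K) - F (Inf K)) \<le> real n * (Sup K - Inf K) + integral K (r n)"
        using int K \<open>((\<lambda>\<tau>. real n + r n \<tau>) has_integral _) _\<close> by (simp add: integral_unique)
    qed
    also have "\<dots> = real n * (\<Sum>K\<in>\<D>. Sup K - Inf K) + (\<Sum>K\<in>\<D>. integral K (r n))"
      by (simp add: sum.distrib sum_distrib_left)
    also have "(\<Sum>K\<in>\<D>. integral K (r n)) = integral (\<Union>\<D>) (r n)"
    proof (rule integral_combine_division_bottomup[OF div(1), symmetric])
      show "r n integrable_on K" if "K \<in> \<D>" for K
        using division_cases[OF div(1) that] div(2) rK by (metis subset_trans)
    qed
    also have "\<dots> \<le> integral {c..d} (r n)"
    proof (rule integral_subset_le[OF div(2)])
      show "r n integrable_on \<Union>\<D>"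
      proof (rule integrable_combine_division[OF div(1)])
        show "r n integrable_on K" if "K \<in> \<D>" for K
          using division_cases[OF div(1) that] div(2) rK by (metis subset_trans)
      qed
      show "r n integrable_on {c..d}"
        using rK by blast
    qed (auto simp: r_def)
    also have "real n * (\<Sum>K\<in>\<D>. Sup K - Inf K) \<le> real n * \<delta>"
      using len by (intro mult_left_mono) auto
    also have "\<dots> \<le> \<epsilon> / 2"
      using \<epsilon> by (simp add: \<delta>_def field_simps)
    finally show ?thesis
      using n by simp
  qed
  with \<delta> show "\<exists>\<delta>>0. \<forall>\<D>. \<D> \<in> partial_divisions {c..d} \<longrightarrow> (\<Sum>K\<in>\<D>. Sup K - Inf K) < \<delta> \<longrightarrow>
       (\<Sum>K\<in>\<D>. cmod (F (Sup K) - F (Inf K))) < \<epsilon>"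
    by blast
qed

text \<open>By the mean value inequality applied to \<open>f\<close> minus its presumed tangent. It gives
differentiability at an interaction point where the two one-sided derivatives agree.\<close>

lemma has_vector_derivative_of_limit:
  fixes f :: "real \<Rightarrow> complex"
  assumes cont: "isCont f c" and der: "eventually (\<lambda>t. (f has_vector_derivative f' t) (at t)) (at c)"
    and lim: "(f' \<longlongrightarrow> l) (at c)"
  shows "(f has_vector_derivative l) (at c)"
proof -
  define \<phi> where "\<phi> t = f t - (t - c) *\<^sub>R l" for t
  have "\<exists>d>0. \<forall>y. norm (y - c) < d \<longrightarrow> norm (f y - f c - (y - c) *\<^sub>R l) \<le> e * norm (y - c)"
    if e: "e > 0" for e
  proof -
    have "eventually (\<lambda>t. (f has_vector_derivative f' t) (at t) \<and> dist (f' t) l < e) (at c)"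
      using der lim e by (intro eventually_conj) (auto simp: tendsto_iff)
    then obtain d where d: "d > 0" "\<And>t. t \<noteq> c \<Longrightarrow> \<bar>t - c\<bar> < d \<Longrightarrow> (f has_vector_derivative f' t) (at t) \<and> dist (f' t) l < e"
      unfolding eventually_at by (auto simp: dist_real_def)
    have \<phi>': "(\<phi> has_derivative (\<lambda>h. h *\<^sub>R (f' t - l))) (at t)" if "t \<noteq> c" "\<bar>t - c\<bar> < d" for t
    proof -
      have "(f has_vector_derivative f' t) (at t)"
        using d(2) that by blast
      then have "(\<phi> has_vector_derivative (f' t - l)) (at t)"
        unfolding \<phi>_def[abs_def] by (auto intro!: derivative_eq_intros)
      then show ?thesis
        by (simp add: has_vector_derivative_def)
    qed
    have \<phi>c: "isCont \<phi> t" if "\<bar>t - c\<bar> < d" for t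
    proof (cases "t = c")
      case True
      then show ?thesis
        unfolding \<phi>_def[abs_def] using cont by (intro continuous_intros) auto
    next
      case False
      then show ?thesis
        using \<phi>'[OF _ that] has_derivative_continuous by blast
    qed
    have mv: "norm (\<phi> t - \<phi> s) \<le> e * (t - s)"
      if st: "s < t" "\<bar>s - c\<bar> < d" "\<bar>t - c\<bar> < d" "c \<notin> {s<..<t}" for s t
    proof -
      have cl: "\<bar>r - c\<bar> < d" if "r \<in> {s..t}" for r
        using that st by auto
      have "continuous_on {s..t} \<phi>"
        using \<phi>c cl by (auto intro!: continuous_at_imp_continuous_on)
      moreover have "(\<phi> has_derivative (\<lambda>h. h *\<^sub>R (f' r - l))) (at r)" if "s < r" "r < t" for r
        using that st(4) by (intro \<phi>' cl) auto
      ultimately obtain r where r: "r \<in> {s<..<t}" "norm (\<phi> t - \<phi> s) \<le> norm ((t - s) *\<^sub>R (f' r - l))"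
        using mvt_general[OF st(1), of \<phi> "\<lambda>r h. h *\<^sub>R (f' r - l)"] by auto
      have "r \<noteq> c" "\<bar>r - c\<bar> < d"
        using r(1) st(4) cl[of r] by auto
      then have "norm (f' r - l) \<le> e"
        using d(2)[of r] by (auto simp: dist_norm)
      then have "norm ((t - s) *\<^sub>R (f' r - l)) \<le> (t - s) * e"
        using st(1) by (simp add: mult_left_mono)
      with r(2) show ?thesis
        by (simp add: mult.commute)
    qed
    show ?thesis
    proof (intro exI[of _ d] conjI allI impI)
      show "d > 0" by fact
      fix y assume y: "norm (y - c) < d"
      have eq: "f y - f c - (y - c) *\<^sub>R l = \<phi> y - \<phi> c"
        by (simp add: \<phi>_def)
      consider "y < c" | "y = c" | "c < y" by linarith
      then show "norm (f y - f c - (y - c) *\<^sub>R l) \<le> e * norm (y - c)"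
      proof cases
        case 1
        then show ?thesis
          using mv[of y c] y d(1) unfolding eq by (simp add: norm_minus_commute)
      next
        case 3
        then show ?thesis
          using mv[of c y] y d(1) unfolding eq by simp
      qed simp
    qed
  qed
  then show ?thesis
    unfolding has_vector_derivative_def has_derivative_at_alt
    by (auto intro: bounded_linear_scaleR_left)
qed

section \<open>Solutions and their Wronskians\<close>

text \<open>Used for functions like the Wronskian, whose values at the interaction points are meaningless
because the derivatives do not exist there; hence the punctured neighbourhoods.\<close>

lemma locally_constant_off_points_imp_constant:
  fixes F :: "real \<Rightarrow> 'a"
  assumes S: "open S" "connected S" "S \<noteq> {}"
    and loc: "\<And>c. c \<in> S \<Longrightarrow> \<exists>k. eventually (\<lambda>t. F t = k) (at c)"
  obtains k where "\<And>c. c \<in> S \<Longrightarrow> eventually (\<lambda>t. F t = k) (at c)"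
proof -
  define G where "G c = (SOME k. eventually (\<lambda>t. F t = k) (at c))" for c
  have G: "eventually (\<lambda>t. F t = G c) (at c)" if "c \<in> S" for c
    unfolding G_def using loc[OF that] by (rule someI_ex)
  have uniq: "k = k'" if "eventually (\<lambda>t. F t = k) (at c)" "eventually (\<lambda>t. F t = k') (at c)" for k k' c
  proof -
    have "eventually (\<lambda>t. k = k') (at c)"
      using that by eventually_elim simp
    then show ?thesis
      by simp
  qed
  have "G constant_on S"
  proof (rule locally_constant_imp_constant[OF S(2)])
    fix c assume c: "c \<in> S"
    obtain T where T: "open T" "c \<in> T" "\<And>t. t \<in> T \<Longrightarrow> t \<noteq> c \<Longrightarrow> F t = G c"
      using G[OF c] unfolding eventually_at_topological by auto
    show "\<exists>U. openin (top_of_set S) U \<and> c \<in> U \<and> (\<forall>t\<in>U. G t = G c)"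
    proof (intro exI conjI ballI)
      show "openin (top_of_set S) (S \<inter> T)"
        using T(1) by (simp add: openin_open_Int)
      show "c \<in> S \<inter> T"
        using c T by blast
      fix t assume t: "t \<in> S \<inter> T"
      show "G t = G c"
      proof (cases "t = c")
        case False
        have "eventually (\<lambda>s. s \<in> T \<and> s \<noteq> c) (at t)"
          using t T(1) False by (intro eventually_conj eventually_at_in_open' t1_space_nhds) 
             (auto intro: eventually_at_in_open' eventually_neq_at_within)
        then have "eventually (\<lambda>s. F s = G c) (at t)"
          by eventually_elim (use T(3) in auto)
        with G[of t] t uniq show ?thesis
          by blast
      qed simp
    qed
  qed
  then obtain k where "\<And>c. c \<in> S \<Longrightarrow> G c = k"
    unfolding constant_on_def by blast
  with G that show ?thesis
    by metis
qed

abbreviation wronskian :: "(real \<Rightarrow> complex) \<Rightarrow> (real \<Rightarrow> complex) \<Rightarrow> real \<Rightarrow> complex" where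
  "wronskian f g t \<equiv> f t * D1 g t - D1 f t * g t"

locale point_interactions =
  fixes a b :: ereal and V :: "real \<Rightarrow> real" and I :: "int set" and x :: "int \<Rightarrow> real"
  assumes V_loc: "L1_loc a b V"
    and x_inj: "inj_on x I"
    and x_inside: "x ` I \<subseteq> einterval a b"
    and x_discrete: "\<And>t. t \<in> einterval a b \<Longrightarrow> \<not> t islimpt (x ` I)"
begin

abbreviation J :: "real set" where "J \<equiv> einterval a b"
abbreviation M :: "real set" where "M \<equiv> x ` I"

text \<open>Bounds the coefficients of the first-order system for \<open>(f, f')\<close> that is equivalent to
\<open>f'' = (V - z) f\<close>.\<close>

definition weight :: "complex \<Rightarrow> real \<Rightarrow> real" where
  "weight z t = 1 + cmod (of_real (V t) - z)"

lemma V_minus_integrable: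
  assumes "{s..t} \<subseteq> J"
  shows "(\<lambda>\<tau>. of_real (V \<tau>) - z :: complex) absolutely_integrable_on {s..t}"
proof -
  have "V absolutely_integrable_on {s..t}"
    using V_loc assms unfolding L1_loc_def by blast
  then have "(\<lambda>\<tau>. of_real (V \<tau>) :: complex) absolutely_integrable_on {s..t}"
    using absolutely_integrable_linear[OF _ bounded_linear_of_real] by (simp add: o_def)
  then show ?thesis
    by (intro set_integral_diff) auto
qed

lemma weight_integrable:
  assumes "{s..t} \<subseteq> J"
  shows "weight z integrable_on {s..t}"
proof -
  have "(\<lambda>\<tau>. cmod (of_real (V \<tau>) - z)) integrable_on {s..t}"
    using V_minus_integrable[OF assms, of z] by (simp add: absolutely_integrable_on_def)
  then show ?thesis
    unfolding weight_def[abs_def] by (intro integrable_add integrable_const_ivl)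
qed

lemma isolating_interval:
  assumes c: "c \<in> J"
  obtains \<delta> where "\<delta> > 0" "{c-\<delta>..c+\<delta>} \<subseteq> J" "M \<inter> {c-\<delta>..c+\<delta>} \<subseteq> {c}"
    "integral {c-\<delta>..c+\<delta>} (weight z) \<le> 1/2"
proof -
  obtain e1 where e1: "e1 > 0" "cball c e1 \<subseteq> J"
    using c open_contains_cball[of J] by auto
  obtain T where T: "c \<in> T" "open T" "\<And>y. y \<in> M \<Longrightarrow> y \<in> T \<Longrightarrow> y = c"
    using x_discrete[OF c] unfolding islimpt_def by blast
  obtain e2 where e2: "e2 > 0" "cball c e2 \<subseteq> T"
    using T open_contains_cball[of T] by auto
  let ?l = "c - e1" and ?u = "c + e1"
  let ?G = "\<lambda>t. integral {?l..t} (weight z)"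
  have sub: "{?l..?u} \<subseteq> J"
    using e1 by (auto simp: cball_eq_atLeastAtMost)
  have int: "weight z integrable_on {?l..?u}"
    by (rule weight_integrable[OF sub])
  have "continuous_on {?l..?u} ?G"
    by (rule indefinite_integral_continuous_1[OF int])
  then have "isCont ?G c"
    using e1 by (intro continuous_on_interior) auto
  then obtain e3 where e3: "e3 > 0" "\<And>t. \<bar>t - c\<bar> < e3 \<Longrightarrow> \<bar>?G t - ?G c\<bar> < 1/4"
    unfolding continuous_at_eps_delta dist_real_def by (metis zero_less_divide_1_iff zero_less_numeral)
  define \<delta> where "\<delta> = min e1 (min e2 (e3/2))"
  have \<delta>: "\<delta> > 0" "\<delta> \<le> e1" "\<delta> \<le> e2" "\<delta> < e3"
    using e1(1) e2(1) e3(1) by (auto simp: \<delta>_def)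
  show ?thesis
  proof
    show "\<delta> > 0" by fact
    show "{c-\<delta>..c+\<delta>} \<subseteq> J"
      using sub \<delta> by auto
    show "M \<inter> {c-\<delta>..c+\<delta>} \<subseteq> {c}"
    proof
      fix y assume y: "y \<in> M \<inter> {c-\<delta>..c+\<delta>}"
      then have "y \<in> cball c e2"
        using \<delta> by (auto simp: cball_eq_atLeastAtMost)
      with T(3)[of y] y e2(2) show "y \<in> {c}"
        by auto
    qed
    have "?G (c - \<delta>) + integral {c-\<delta>..c+\<delta>} (weight z) = ?G (c + \<delta>)"
      using \<delta> by (intro Henstock_Kurzweil_Integration.integral_combine integrable_on_subinterval[OF int]) auto
    then show "integral {c-\<delta>..c+\<delta>} (weight z) \<le> 1/2"
      using e3(2)[of "c - \<delta>"] e3(2)[of "c + \<delta>"] \<delta> by (simp add: abs_if split: if_splits)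
  qed
qed

lemma solution_continuous:
  assumes f: "solution a b V I x \<omega> z f" and c: "c \<in> J"
  shows "isCont f c"
proof (cases "c \<in> M")
  case True
  then have "(f \<longlongrightarrow> f c) (at_left c)" "(f \<longlongrightarrow> f c) (at_right c)"
    using f by (auto simp: solution_def delta_condition_def)
  then show ?thesis
    unfolding isCont_def by (simp add: filterlim_at_split)
next
  case False
  then have "f differentiable (at c)"
    using f c by (auto simp: solution_def regularity_off_def)
  then show ?thesis
    by (rule differentiable_imp_continuous_within)
qed

lemma solution_deriv:
  assumes f: "solution a b V I x \<omega> z f" and c: "c \<in> J - M"
  shows "(f has_vector_derivative D1 f c) (at c)"
proof -
  have "f differentiable (at c)"
    using f c by (simp add: solution_def regularity_off_def)
  then show ?thesis
    by (simp add: vector_derivative_works)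
qed

lemma solution_abs_continuous:
  assumes f: "solution a b V I x \<omega> z f" and st: "{s..t} \<subseteq> J - M"
  shows "abs_continuous_on {s..t} f" "abs_continuous_on {s..t} (D1 f)"
proof -
  have "loc_abs_continuous_on (J - M) f" "loc_abs_continuous_on (J - M) (D1 f)"
    using f by (simp_all add: solution_def regularity_off_def)
  then show "abs_continuous_on {s..t} f" "abs_continuous_on {s..t} (D1 f)"
    using st unfolding loc_abs_continuous_on_def by simp_all
qed

text \<open>The almost everywhere equation refers to \<open>D1 (D1 f)\<close>, which carries information only where \<open>D1 f\<close> is
differentiable; this is almost everywhere by absolute continuity.\<close>

lemma solution_second_deriv:
  assumes f: "solution a b V I x \<omega> z f" and st: "{s..t} \<subseteq> J - M"
  obtains N where "negligible N" 
    "\<And>\<tau>. \<tau> \<in> {s..t} - N \<Longrightarrow> (D1 f has_vector_derivative (of_real (V \<tau>) - z) * f \<tau>) (at \<tau>)"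
proof -
  have "AE \<tau> in lebesgue_on J. tau V f \<tau> - z * f \<tau> = 0"
    using f by (simp add: solution_def)
  then have "AE \<tau> in lebesgue. \<tau> \<in> J \<longrightarrow> tau V f \<tau> - z * f \<tau> = 0"
    by (subst (asm) AE_restrict_space_iff) auto
  then obtain N where N: "negligible N" "{\<tau>. \<not> (\<tau> \<in> J \<longrightarrow> tau V f \<tau> - z * f \<tau> = 0)} \<subseteq> N"
    unfolding eventually_ae_filter_negligible by blast
  \<comment> \<open>The endpoints are added because differentiability is known in the open interval only.\<close>
  define N' where "N' = N \<union> {\<tau> \<in> {s<..<t}. \<not> D1 f differentiable (at \<tau>)} \<union> {s, t}"
  show ?thesis
  proof (rule that[of N'])
    show "negligible N'"
      unfolding N'_def using N abs_continuous_negligible_not_differentiable[OF solution_abs_continuous(2)[OF f st]]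
      by simp
    fix \<tau> assume \<tau>: "\<tau> \<in> {s..t} - N'"
    then have "D1 f differentiable (at \<tau>)"
      by (auto simp: N'_def)
    then have "(D1 f has_vector_derivative D1 (D1 f) \<tau>) (at \<tau>)"
      using vector_derivative_works by blast
    moreover have "tau V f \<tau> - z * f \<tau> = 0"
      using \<tau> N(2) st by (auto simp: N'_def)
    then have "D1 (D1 f) \<tau> = (of_real (V \<tau>) - z) * f \<tau>"
      by (simp add: tau_def algebra_simps)
    ultimately show "(D1 f has_vector_derivative (of_real (V \<tau>) - z) * f \<tau>) (at \<tau>)"
      by simp
  qed
qed

lemma solution_integral:
  assumes f: "solution a b V I x \<omega> z f" and st: "{s..t} \<subseteq> J - M" "s \<le> t"
  shows "(D1 f has_integral (f t - f s)) {s..t}"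
    and "((\<lambda>\<tau>. (of_real (V \<tau>) - z) * f \<tau>) has_integral (D1 f t - D1 f s)) {s..t}"
proof -
  show "(D1 f has_integral (f t - f s)) {s..t}"
  proof (rule fundamental_theorem_of_calculus[OF st(2)])
    show "(f has_vector_derivative D1 f \<tau>) (at \<tau> within {s..t})" if "\<tau> \<in> {s..t}" for \<tau>
      by (rule has_vector_derivative_at_within[OF solution_deriv[OF f subsetD[OF st(1) that]]])
  qed
  obtain N where "negligible N" 
    "\<And>\<tau>. \<tau> \<in> {s..t} - N \<Longrightarrow> (D1 f has_vector_derivative (of_real (V \<tau>) - z) * f \<tau>) (at \<tau>)"
    by (rule solution_second_deriv[OF f st(1)]) blast
  then show "((\<lambda>\<tau>. (of_real (V \<tau>) - z) * f \<tau>) has_integral (D1 f t - D1 f s)) {s..t}"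
    by (rule abs_continuous_has_integral[OF solution_abs_continuous(2)[OF f st(1)] st(2)])
qed

text \<open>In the derivative \<open>f g'' - f'' g\<close> the two terms \<open>(V - z) f g\<close> cancel almost everywhere, and the
Wronskian is absolutely continuous.\<close>

lemma wronskian_constant:
  assumes f: "solution a b V I x \<omega> z f" and g: "solution a b V I x \<omega>' z g"
    and st: "{s..t} \<subseteq> J - M" "s \<le> t"
  shows "wronskian f g t = wronskian f g s"
proof -
  obtain N where N: "negligible N" 
    "\<And>\<tau>. \<tau> \<in> {s..t} - N \<Longrightarrow> (D1 f has_vector_derivative (of_real (V \<tau>) - z) * f \<tau>) (at \<tau>)"
    by (rule solution_second_deriv[OF f st(1)]) blast
  obtain N' where N': "negligible N'" 
    "\<And>\<tau>. \<tau> \<in> {s..t} - N' \<Longrightarrow> (D1 g has_vector_derivative (of_real (V \<tau>) - z) * g \<tau>) (at \<tau>)"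
    by (rule solution_second_deriv[OF g st(1)]) blast
  have "abs_continuous_on {s..t} (wronskian f g)"
    by (intro abs_continuous_on_diff abs_continuous_on_mult solution_abs_continuous[OF f st(1)] 
        solution_abs_continuous[OF g st(1)])
  moreover have "(wronskian f g has_vector_derivative 0) (at \<tau>)" if \<tau>: "\<tau> \<in> {s..t} - (N \<union> N')" for \<tau>
  proof -
    have d: "(f has_vector_derivative D1 f \<tau>) (at \<tau>)" "(g has_vector_derivative D1 g \<tau>) (at \<tau>)"
      using \<tau> st(1) by (auto intro: solution_deriv[OF f] solution_deriv[OF g])
    have "(wronskian f g has_vector_derivative
       (f \<tau> * ((of_real (V \<tau>) - z) * g \<tau>) + D1 f \<tau> * D1 g \<tau>) - 
       (D1 f \<tau> * D1 g \<tau> + ((of_real (V \<tau>) - z) * f \<tau>) * g \<tau>)) (at \<tau>)"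
      by (intro has_vector_derivative_diff has_vector_derivative_mult d N N') (use \<tau> in auto)
    then show ?thesis
      by (simp add: algebra_simps)
  qed
  ultimately have "((\<lambda>_. 0) has_integral (wronskian f g t - wronskian f g s)) {s..t}"
    using N(1) N'(1) st(2) by (intro abs_continuous_has_integral[of s t "wronskian f g" "N \<union> N'"]) simp_all
  from has_integral_unique[OF this has_integral_0] show ?thesis
    by simp
qed

text \<open>The couplings as a function of position, extended by \<open>0\<close>: the condition
\<open>f'(c+) - f'(c-) = jump \<omega> c * f c\<close> then holds at every point of the interval.\<close>

definition jump :: "(int \<Rightarrow> real) \<Rightarrow> real \<Rightarrow> real" where
  "jump \<omega> c = (if c \<in> M then \<omega> (the_inv_into I x c) else 0)"

lemma jump_x: "n \<in> I \<Longrightarrow> jump \<omega> (x n) = \<omega> n"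
  by (simp add: jump_def the_inv_into_f_f[OF x_inj])

lemma jump_notin: "c \<notin> M \<Longrightarrow> jump \<omega> c = 0"
  by (simp add: jump_def)

lemma solution_deriv_continuous:
  assumes f: "solution a b V I x \<omega> z f" and c: "c \<in> J - M"
  shows "isCont (D1 f) c"
proof -
  obtain \<delta> where \<delta>: "\<delta> > 0" "{c-\<delta>..c+\<delta>} \<subseteq> J" "M \<inter> {c-\<delta>..c+\<delta>} \<subseteq> {c}"
    by (rule isolating_interval[OF DiffD1[OF c], of 0]) blast
  then have "{c-\<delta>..c+\<delta>} \<subseteq> J - M"
    using c by auto
  then have "continuous_on {c-\<delta>..c+\<delta>} (D1 f)"
    using solution_abs_continuous(2)[OF f] abs_continuous_on_imp_continuous_on by blast
  then show ?thesis
    using \<delta>(1) by (intro continuous_on_interior) auto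
qed

lemma solution_one_sided_derivs:
  assumes f: "solution a b V I x \<omega> z f" and c: "c \<in> J"
  obtains l r where "(D1 f \<longlongrightarrow> l) (at_left c)" "(D1 f \<longlongrightarrow> r) (at_right c)"
    "r - l = of_real (jump \<omega> c) * f c"
proof (cases "c \<in> M")
  case True
  then obtain n where n: "n \<in> I" "c = x n"
    by blast
  then have "delta_condition (\<omega> n) c f"
    using f by (auto simp: solution_def)
  with that n show ?thesis
    by (auto simp: delta_condition_def jump_x)
next
  case False
  then have "(D1 f \<longlongrightarrow> D1 f c) (at c)"
    using solution_deriv_continuous[OF f] c by (simp add: isCont_def)
  with that[of "D1 f c" "D1 f c"] False show ?thesis
    by (simp add: filterlim_at_split jump_notin)
qed

text \<open>Near \<open>c\<close> there are no other interaction points, so the Wronskian is constant on either side; the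
two constants are its one-sided limits, which are computed from those of the derivatives.\<close>

lemma wronskian_jump:
  assumes f: "solution a b V I x \<omega> z f" and g: "solution a b V I x \<omega>' z g" and c: "c \<in> J"
  obtains k l where "eventually (\<lambda>t. wronskian f g t = k) (at_left c)"
    "eventually (\<lambda>t. wronskian f g t = l) (at_right c)"
    "l - k = of_real (jump \<omega>' c - jump \<omega> c) * f c * g c"
proof -
  obtain \<delta> where \<delta>: "\<delta> > 0" "{c-\<delta>..c+\<delta>} \<subseteq> J" "M \<inter> {c-\<delta>..c+\<delta>} \<subseteq> {c}"
    by (rule isolating_interval[OF c, of 0]) blast
  have const: "wronskian f g t = wronskian f g s" if "{min s t..max s t} \<subseteq> J - M" for s t
    using wronskian_constant[OF f g, of "min s t" "max s t"] that by (cases "s \<le> t") auto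
  have gap: "{s..t} \<subseteq> J - M" if "c - \<delta> < s" "t < c + \<delta>" "t < c \<or> c < s" for s t
  proof
    fix y assume "y \<in> {s..t}"
    then have "y \<in> {c-\<delta>..c+\<delta>}" "y \<noteq> c"
      using that by auto
    then show "y \<in> J - M"
      using \<delta>(2,3) by blast
  qed
  define k where "k = wronskian f g (c - \<delta>/2)"
  define l where "l = wronskian f g (c + \<delta>/2)"
  have k: "eventually (\<lambda>t. wronskian f g t = k) (at_left c)"
  proof -
    have "wronskian f g t = k" if "c - \<delta> < t" "t < c" for t
      unfolding k_def using that \<delta>(1) by (intro const gap) auto
    then show ?thesis
      using \<delta>(1) unfolding eventually_at_left_field by (intro exI[of _ "c - \<delta>"]) auto
  qed
  have l: "eventually (\<lambda>t. wronskian f g t = l) (at_right c)"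
  proof -
    have "wronskian f g t = l" if "c < t" "t < c + \<delta>" for t
      unfolding l_def using that \<delta>(1) by (intro const gap) auto
    then show ?thesis
      using \<delta>(1) unfolding eventually_at_right_field by (intro exI[of _ "c + \<delta>"]) auto
  qed
  have cont: "(h \<longlongrightarrow> h c) (at_left c)" "(h \<longlongrightarrow> h c) (at_right c)" if "isCont h c" for h :: "real \<Rightarrow> complex"
    using that by (auto simp: isCont_def filterlim_at_split)
  note cf = cont[OF solution_continuous[OF f c]] and cg = cont[OF solution_continuous[OF g c]]
  obtain fl fr where fd: "(D1 f \<longlongrightarrow> fl) (at_left c)" "(D1 f \<longlongrightarrow> fr) (at_right c)"
      "fr - fl = of_real (jump \<omega> c) * f c"
    by (rule solution_one_sided_derivs[OF f c])
  obtain gl gr where gd: "(D1 g \<longlongrightarrow> gl) (at_left c)" "(D1 g \<longlongrightarrow> gr) (at_right c)"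
      "gr - gl = of_real (jump \<omega>' c) * g c"
    by (rule solution_one_sided_derivs[OF g c])
  have "(wronskian f g \<longlongrightarrow> f c * gl - fl * g c) (at_left c)"
    by (intro tendsto_intros cf cg fd gd)
  then have kk: "k = f c * gl - fl * g c"
    using tendsto_eventually[OF k] tendsto_unique trivial_limit_at_left_real by blast
  have "(wronskian f g \<longlongrightarrow> f c * gr - fr * g c) (at_right c)"
    by (intro tendsto_intros cf cg fd gd)
  then have ll: "l = f c * gr - fr * g c"
    using tendsto_eventually[OF l] tendsto_unique trivial_limit_at_right_real by blast
  have "l - k = f c * (gr - gl) - (fr - fl) * g c"
    by (simp add: kk ll algebra_simps)
  also have "\<dots> = of_real (jump \<omega>' c - jump \<omega> c) * f c * g c"
    by (simp add: fd gd algebra_simps)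
  finally show ?thesis
    using that k l by blast
qed

lemma wronskian_constant_across:
  assumes f: "solution a b V I x \<omega> z f" and g: "solution a b V I x \<omega>' z g"
    and S: "open S" "connected S" "S \<noteq> {}" "S \<subseteq> J"
    and eq: "\<And>n. n \<in> I \<Longrightarrow> x n \<in> S \<Longrightarrow> \<omega> n = \<omega>' n"
  obtains k where "\<And>c. c \<in> S \<Longrightarrow> eventually (\<lambda>t. wronskian f g t = k) (at c)"
proof (rule locally_constant_off_points_imp_constant[OF S(1-3), of "wronskian f g"])
  fix c assume c: "c \<in> S"
  obtain k l where kl: "eventually (\<lambda>t. wronskian f g t = k) (at_left c)"
    "eventually (\<lambda>t. wronskian f g t = l) (at_right c)"
    "l - k = of_real (jump \<omega>' c - jump \<omega> c) * f c * g c"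
    using wronskian_jump[OF f g] c S(4) by blast
  have "jump \<omega>' c = jump \<omega> c"
    using eq c jump_x jump_notin by (cases "c \<in> M") auto
  with kl have "eventually (\<lambda>t. wronskian f g t = k) (at c)"
    by (simp add: eventually_at_split)
  then show "\<exists>k. eventually (\<lambda>t. wronskian f g t = k) (at c)"
    by blast
qed (use that in blast)

end

section \<open>Uniqueness for the Cauchy problem\<close>

lemma einterval_mono: "a \<le> a' \<Longrightarrow> b' \<le> b \<Longrightarrow> einterval a' b' \<subseteq> einterval a b"
  by (auto simp: einterval_iff intro: le_less_trans less_le_trans)

lemma connected_einterval: "connected (einterval a b)"
  unfolding connected_iff_interval
proof (intro ballI allI impI)
  fix s t r assume "s \<in> einterval a b" "t \<in> einterval a b" "s \<le> r" "r \<le> t"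
  then show "r \<in> einterval a b"
    using less_le_trans[of a "ereal s" "ereal r"] le_less_trans[of "ereal r" "ereal t" b]
    by (simp add: einterval_iff)
qed

context point_interactions
begin

definition cauchy_size :: "(real \<Rightarrow> complex) \<Rightarrow> real \<Rightarrow> real" where
  "cauchy_size f t = cmod (f t) + cmod (D1 f t)"

text \<open>A Gronwall estimate for short intervals. Let \<open>m\<close> be the maximum of the Cauchy data. By the
integral equations the data change by at most \<open>m\<close> times the integral of the weight, that is by at
most \<open>m/2\<close>; hence \<open>m\<close> is at most twice the size of the data at any point.\<close>

lemma cauchy_size_comparable:
  assumes f: "solution a b V I x \<omega> z f" and uv: "{u..v} \<subseteq> J - M"
    and w: "integral {u..v} (weight z) \<le> 1/2" and s: "s \<in> {u..v}" and t: "t \<in> {u..v}"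
  shows "cauchy_size f t \<le> 2 * cauchy_size f s"
proof -
  have "continuous_on {u..v} (cauchy_size f)"
    unfolding cauchy_size_def[abs_def]
    by (intro continuous_intros abs_continuous_on_imp_continuous_on solution_abs_continuous[OF f uv])
  moreover have "{u..v} \<noteq> {}"
    using s by auto
  ultimately obtain \<tau> where \<tau>: "\<tau> \<in> {u..v}" "\<And>r. r \<in> {u..v} \<Longrightarrow> cauchy_size f r \<le> cauchy_size f \<tau>"
    using continuous_attains_sup[of "{u..v}" "cauchy_size f"] by auto
  define m where "m = cauchy_size f \<tau>"
  have m0: "m \<ge> 0"
    by (simp add: m_def cauchy_size_def)
  have fm: "cmod (f r) \<le> m" "cmod (D1 f r) \<le> m" if "r \<in> {u..v}" for r
    using \<tau>(2)[OF that] norm_ge_zero[of "f r"] norm_ge_zero[of "D1 f r"]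
    unfolding m_def cauchy_size_def[of f r] by linarith+
  have step: "cmod (f r - f q) + cmod (D1 f r - D1 f q) \<le> m / 2" if qr: "u \<le> q" "q \<le> r" "r \<le> v" for q r
  proof -
    have quv: "{q..r} \<subseteq> {u..v}"
      using qr by auto
    then have sub: "{q..r} \<subseteq> J - M" "{q..r} \<subseteq> {u..v}" "{q..r} \<subseteq> J"
      using uv by blast+
    have int1: "(\<lambda>_. m) integrable_on {q..r}"
      by (rule integrable_const_ivl)
    have "(\<lambda>y. cmod (of_real (V y) - z)) integrable_on {q..r}"
      using V_minus_integrable[OF sub(3), of z] by (simp add: absolutely_integrable_on_def)
    then have int2: "(\<lambda>y. m * cmod (of_real (V y) - z)) integrable_on {q..r}"
      using integrable_cmul[of _ _ m] by fastforce
    note i1 = solution_integral(1)[OF f sub(1) qr(2)] and i2 = solution_integral(2)[OF f sub(1) qr(2)]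
    have "cmod (integral {q..r} (D1 f)) \<le> integral {q..r} (\<lambda>_. m)"
    proof (rule Henstock_Kurzweil_Integration.integral_norm_bound_integral[OF has_integral_integrable[OF i1] int1])
      show "cmod (D1 f y) \<le> m" if "y \<in> {q..r}" for y
        using fm(2) subsetD[OF sub(2) that] .
    qed
    then have 1: "cmod (f r - f q) \<le> integral {q..r} (\<lambda>_. m)"
      unfolding integral_unique[OF i1] .
    have "cmod (integral {q..r} (\<lambda>\<tau>. (of_real (V \<tau>) - z) * f \<tau>)) \<le> integral {q..r} (\<lambda>y. m * cmod (of_real (V y) - z))"
    proof (rule Henstock_Kurzweil_Integration.integral_norm_bound_integral[OF has_integral_integrable[OF i2] int2])
      fix y assume "y \<in> {q..r}"
      then have "cmod (f y) \<le> m"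
        using fm(1) subsetD[OF sub(2)] by blast
      then show "cmod ((of_real (V y) - z) * f y) \<le> m * cmod (of_real (V y) - z)"
        unfolding norm_mult by (subst mult.commute, intro mult_right_mono) auto
    qed
    then have 2: "cmod (D1 f r - D1 f q) \<le> integral {q..r} (\<lambda>y. m * cmod (of_real (V y) - z))"
      unfolding integral_unique[OF i2] .
    have "integral {q..r} (\<lambda>_. m) + integral {q..r} (\<lambda>y. m * cmod (of_real (V y) - z)) =
        integral {q..r} (\<lambda>y. m * weight z y)"
      unfolding Henstock_Kurzweil_Integration.integral_add[OF int1 int2, symmetric] by (simp add: weight_def algebra_simps)
    also have "\<dots> = m * integral {q..r} (weight z)"
      by simp
    also have "integral {q..r} (weight z) \<le> integral {u..v} (weight z)"
    proof (intro integral_subset_le[OF sub(2)] weight_integrable sub(3))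
      show "{u..v} \<subseteq> J"
        using uv by blast
    qed (simp add: weight_def)
    also have "\<dots> \<le> 1/2" by (rule w)
    finally show ?thesis
      using 1 2 m0 by (simp add: mult_left_mono)
  qed
  have "cmod (f \<tau> - f s) + cmod (D1 f \<tau> - D1 f s) \<le> m / 2"
    using step[of s \<tau>] step[of \<tau> s] s \<tau>(1) by (cases "s \<le> \<tau>") (auto simp: norm_minus_commute)
  moreover have "cmod (f \<tau>) \<le> cmod (f s) + cmod (f \<tau> - f s)" "cmod (D1 f \<tau>) \<le> cmod (D1 f s) + cmod (D1 f \<tau> - D1 f s)"
    using norm_triangle_sub[of "f \<tau>" "f s"] norm_triangle_sub[of "D1 f \<tau>" "D1 f s"] by simp_all
  ultimately have "m \<le> cauchy_size f s + m / 2"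
    unfolding m_def cauchy_size_def by linarith
  then show ?thesis
    using \<tau>(2)[OF t] by (simp add: m_def)
qed

text \<open>On either side of a point, the preceding comparison makes the Cauchy data vanish identically or
nowhere, according to whether the one-sided limit vanishes. The jump condition shows that the
two sides agree. So vanishing spreads over the whole interval, across interaction points.\<close>

lemma solution_vanishes_if_cauchy_data_vanish:
  assumes f: "solution a b V I x \<omega> z f" and c: "c \<in> J"
    and zero: "f c = 0" "(D1 f \<longlongrightarrow> 0) (at_left c)"
  shows "\<forall>t\<in>J. f t = 0"
proof -
  have sides: "\<exists>k. eventually (\<lambda>t. (cauchy_size f t = 0) = k) (at c) \<and>
      (k \<longleftrightarrow> f c = 0 \<and> (D1 f \<longlongrightarrow> 0) (at_left c))" if c: "c \<in> J" for c
  proof -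
    obtain \<delta> where \<delta>: "\<delta> > 0" "{c-\<delta>..c+\<delta>} \<subseteq> J" "M \<inter> {c-\<delta>..c+\<delta>} \<subseteq> {c}"
        "integral {c-\<delta>..c+\<delta>} (weight z) \<le> 1/2"
      by (rule isolating_interval[OF c, of z]) blast
    obtain l r where lr: "(D1 f \<longlongrightarrow> l) (at_left c)" "(D1 f \<longlongrightarrow> r) (at_right c)"
        "r - l = of_real (jump \<omega> c) * f c"
      by (rule solution_one_sided_derivs[OF f c])
    have fc: "(f \<longlongrightarrow> f c) (at_left c)" "(f \<longlongrightarrow> f c) (at_right c)"
      using solution_continuous[OF f c] by (auto simp: isCont_def filterlim_at_split)
    have lim: "(cauchy_size f \<longlongrightarrow> cmod (f c) + cmod l) (at_left c)"
       "(cauchy_size f \<longlongrightarrow> cmod (f c) + cmod r) (at_right c)"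
      unfolding cauchy_size_def[abs_def] by (intro tendsto_intros fc lr)+
    have comp: "cauchy_size f t \<le> 2 * cauchy_size f s"
      if st: "c - \<delta> < s \<and> s < c \<and> c - \<delta> < t \<and> t < c \<or> c < s \<and> s < c + \<delta> \<and> c < t \<and> t < c + \<delta>" for s t
    proof -
      have sub: "{min s t..max s t} \<subseteq> {c-\<delta>..c+\<delta>}" "c \<notin> {min s t..max s t}"
        using st by auto
      have w: "integral {min s t..max s t} (weight z) \<le> integral {c-\<delta>..c+\<delta>} (weight z)"
        by (intro integral_subset_le[OF sub(1)] weight_integrable[OF \<delta>(2)]
              weight_integrable[OF subset_trans[OF sub(1) \<delta>(2)]]) (simp add: weight_def)
      show ?thesis
      proof (rule cauchy_size_comparable[OF f])
        show "{min s t..max s t} \<subseteq> J - M"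
          using sub \<delta>(2,3) by blast
      qed (use w \<delta>(4) in auto)
    qed
    have side: "(k = 0 \<longrightarrow> eventually (\<lambda>t. cauchy_size f t = 0) G) \<and> (k \<noteq> 0 \<longrightarrow> eventually (\<lambda>t. cauchy_size f t \<noteq> 0) G)"
      if lim: "(cauchy_size f \<longlongrightarrow> k) G" and ev: "eventually (\<lambda>t. t \<in> S) G" "G \<noteq> bot"
        and comp: "\<And>s t. s \<in> S \<Longrightarrow> t \<in> S \<Longrightarrow> cauchy_size f t \<le> 2 * cauchy_size f s" for k G S
    proof (intro conjI impI)
      assume "k = 0"
      have "cauchy_size f t = 0" if t: "t \<in> S" for t
      proof -
        have "eventually (\<lambda>s. cauchy_size f t \<le> 2 * cauchy_size f s) G"
          using ev(1) by eventually_elim (rule comp[OF _ t])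
        then have "cauchy_size f t \<le> 2 * k"
          by (intro tendsto_lowerbound[OF tendsto_mult_left[OF lim] _ ev(2)])
        with \<open>k = 0\<close> show ?thesis
          using norm_ge_zero[of "f t"] norm_ge_zero[of "D1 f t"] unfolding cauchy_size_def by linarith
      qed
      with ev(1) show "eventually (\<lambda>t. cauchy_size f t = 0) G"
        by (auto elim: eventually_mono)
    next
      assume "k \<noteq> 0"
      with lim show "eventually (\<lambda>t. cauchy_size f t \<noteq> 0) G"
        by (rule tendsto_imp_eventually_ne)
    qed
    have evl: "eventually (\<lambda>t. t \<in> {c-\<delta><..<c}) (at_left c)" "eventually (\<lambda>t. t \<in> {c<..<c+\<delta>}) (at_right c)"
      using \<delta>(1) by (auto intro: eventually_at_leftI eventually_at_rightI)
    define k where "k \<longleftrightarrow> f c = 0 \<and> l = 0"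
    have kl: "k \<longleftrightarrow> cmod (f c) + cmod l = 0" and kr: "k \<longleftrightarrow> cmod (f c) + cmod r = 0"
      using lr(3) by (auto simp: k_def add_nonneg_eq_0_iff)
    have "eventually (\<lambda>t. (cauchy_size f t = 0) = k) (at_left c)"
      using side[OF lim(1) evl(1)] comp kl by (cases k) auto
    moreover have "eventually (\<lambda>t. (cauchy_size f t = 0) = k) (at_right c)"
      using side[OF lim(2) evl(2)] comp kr by (cases k) auto
    ultimately have ev: "eventually (\<lambda>t. (cauchy_size f t = 0) = k) (at c)"
      by (simp add: eventually_at_split)
    have "(D1 f \<longlongrightarrow> 0) (at_left c) \<longleftrightarrow> l = 0"
      using lr(1) tendsto_unique[OF trivial_limit_at_left_real] by metis
    with ev show ?thesis
      by (intro exI[of _ k]) (simp add: k_def)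
  qed
  have ne: "J \<noteq> {}"
    using c by auto
  have loc: "\<exists>k. eventually (\<lambda>t. (cauchy_size f t = 0) = k) (at c)" if "c \<in> J" for c
    using sides[OF that] by blast
  obtain k where k: "\<And>c. c \<in> J \<Longrightarrow> eventually (\<lambda>t. (cauchy_size f t = 0) = k) (at c)"
  proof (rule locally_constant_off_points_imp_constant[OF open_einterval connected_einterval ne loc])
    fix k assume "\<And>c. c \<in> J \<Longrightarrow> eventually (\<lambda>t. (cauchy_size f t = 0) = k) (at c)"
    then show ?thesis
      by (rule that)
  qed
  obtain k' where "eventually (\<lambda>t. (cauchy_size f t = 0) = k') (at c)" k'
    using sides[OF c] zero by blast
  from eventually_conj[OF this(1) k[OF c]] this(2) have k
    by (auto dest: eventually_happens)
  then have k: "eventually (\<lambda>t. cauchy_size f t = 0) (at c)" if "c \<in> J" for c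
    using k[OF that] by simp
  show ?thesis
  proof
    fix t assume t: "t \<in> J"
    obtain k where "eventually (\<lambda>s. (cauchy_size f s = 0) = k) (at t)"
      "k \<longleftrightarrow> f t = 0 \<and> (D1 f \<longlongrightarrow> 0) (at_left t)"
      using sides[OF t] by blast
    moreover from eventually_conj[OF this(1) k[OF t]] have k
      by (auto dest: eventually_happens)
    ultimately show "f t = 0"
      by simp
  qed
qed

section \<open>Behaviour at the endpoints\<close>

lemma L2_on_subset:
  assumes f: "L2_on S f" and T: "T \<subseteq> S" "T \<in> sets borel" "S \<in> sets borel"
  shows "L2_on T f"
proof -
  have TS: "lebesgue_on T = restrict_space (lebesgue_on S) T"
    using T by (simp add: restrict_restrict_space Int_absorb1)
  have "set_integrable lebesgue S (\<lambda>t. (cmod (f t))\<^sup>2)"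
    using f T(3) by (simp add: L2_on_def set_integrable_def integrable_restrict_space)
  then have "set_integrable lebesgue T (\<lambda>t. (cmod (f t))\<^sup>2)"
    by (rule set_integrable_subset) (use T in auto)
  then have "integrable (lebesgue_on T) (\<lambda>t. (cmod (f t))\<^sup>2)"
    using T(2) by (simp add: set_integrable_def integrable_restrict_space)
  moreover have "f \<in> borel_measurable (lebesgue_on T)"
    using f unfolding TS L2_on_def by (auto intro: measurable_restrict_space1)
  ultimately show ?thesis
    by (simp add: L2_on_def)
qed

lemma L2_on_combination:
  assumes f: "L2_on S f" and g: "L2_on S g"
    and h: "\<And>t. t \<in> S \<Longrightarrow> h t = \<alpha> * f t + \<beta> * g t" and S: "S \<in> sets borel"
  shows "L2_on S h"
proof -
  let ?h = "\<lambda>t. \<alpha> * f t + \<beta> * g t"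
  have sp: "space (lebesgue_on S) = S"
    using S by (simp add: space_restrict_space)
  have hm: "?h \<in> borel_measurable (lebesgue_on S)"
    using f g by (auto simp: L2_on_def)
  have m: "h \<in> borel_measurable (lebesgue_on S)"
    using hm by (subst measurable_cong[of _ _ ?h]) (auto simp: sp h)
  have "integrable (lebesgue_on S) (\<lambda>t. 2 * (cmod \<alpha>)\<^sup>2 * (cmod (f t))\<^sup>2 + 2 * (cmod \<beta>)\<^sup>2 * (cmod (g t))\<^sup>2)"
    using f g by (auto simp: L2_on_def)
  moreover have "(\<lambda>t. (cmod (h t))\<^sup>2) \<in> borel_measurable (lebesgue_on S)"
    using m by measurable
  moreover have "(cmod (h t))\<^sup>2 \<le> 2 * (cmod \<alpha>)\<^sup>2 * (cmod (f t))\<^sup>2 + 2 * (cmod \<beta>)\<^sup>2 * (cmod (g t))\<^sup>2" if "t \<in> S" for t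
  proof -
    have "cmod (h t) \<le> cmod \<alpha> * cmod (f t) + cmod \<beta> * cmod (g t)"
      unfolding h[OF that] using norm_triangle_ineq[of "\<alpha> * f t" "\<beta> * g t"] by (simp add: norm_mult)
    then have "(cmod (h t))\<^sup>2 \<le> (cmod \<alpha> * cmod (f t) + cmod \<beta> * cmod (g t))\<^sup>2"
      by (intro power_mono) auto
    also have "\<dots> \<le> 2 * (cmod \<alpha> * cmod (f t))\<^sup>2 + 2 * (cmod \<beta> * cmod (g t))\<^sup>2"
      using sum_squares_bound[of "cmod \<alpha> * cmod (f t)" "cmod \<beta> * cmod (g t)"] by (simp add: power2_sum)
    finally show ?thesis
      by (simp add: power_mult_distrib)
  qed
  ultimately have "integrable (lebesgue_on S) (\<lambda>t. (cmod (h t))\<^sup>2)"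
    by (intro Bochner_Integration.integrable_bound[of _ _ "\<lambda>t. (cmod (h t))\<^sup>2"]) 
       (auto simp: sp intro!: AE_I2)
  with m show ?thesis
    by (simp add: L2_on_def)
qed

text \<open>The boundary values of \<open>f\<close> and \<open>g\<close> are both orthogonal to the nonzero vector
\<open>(cos \<phi>, sin \<phi>)\<close>, hence linearly dependent.\<close>

lemma boundary_condition_wronskian:
  assumes "boundary_condition G \<phi> f" "boundary_condition G \<phi> g" "G \<noteq> bot"
    and k: "eventually (\<lambda>t. wronskian f g t = k) G"
  shows "k = 0"
proof -
  obtain u v where f: "(f \<longlongrightarrow> u) G" "(D1 f \<longlongrightarrow> v) G" "u * of_real (cos \<phi>) + v * of_real (sin \<phi>) = 0"
    using assms(1) unfolding boundary_condition_def by blast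
  obtain u' v' where g: "(g \<longlongrightarrow> u') G" "(D1 g \<longlongrightarrow> v') G" "u' * of_real (cos \<phi>) + v' * of_real (sin \<phi>) = 0"
    using assms(2) unfolding boundary_condition_def by blast
  let ?c = "complex_of_real (cos \<phi>)" and ?s = "complex_of_real (sin \<phi>)"
  have "(wronskian f g \<longlongrightarrow> u * v' - v * u') G"
    by (intro tendsto_intros f g)
  then have keq: "k = u * v' - v * u'"
    using tendsto_eventually[OF k] tendsto_unique[OF assms(3)] by blast
  have cs: "?c * k = 0"
  proof -
    have "?c * k = (u * ?c + v * ?s) * v' - v * (u' * ?c + v' * ?s)"
      by (simp add: keq algebra_simps)
    then show ?thesis
      using f(3) g(3) by simp
  qed
  have sk: "?s * k = 0"
  proof -
    have "?s * k = u * (u' * ?c + v' * ?s) - u' * (u * ?c + v * ?s)"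
      by (simp add: keq algebra_simps)
    then show ?thesis
      using f(3) g(3) by simp
  qed
  have "\<not> (?c = 0 \<and> ?s = 0)"
    using sin_cos_squared_add[of \<phi>] by (auto simp del: sin_cos_squared_add)
  with cs sk show ?thesis
    by auto
qed

text \<open>The identity \<open>h W(f,g) + f W(g,h) + g W(h,f) = 0\<close> with constant Wronskians writes \<open>h\<close> as a
combination of \<open>f\<close> and \<open>g\<close>. It holds off the interaction points and extends to them by continuity.\<close>

lemma third_solution_L2:
  assumes f: "solution a b V I x \<omega> z f" and g: "solution a b V I x \<omega>' z g" and h: "solution a b V I x \<omega> z h"
    and S: "open S" "connected S" "S \<noteq> {}" "S \<subseteq> J"
    and eq: "\<And>n. n \<in> I \<Longrightarrow> x n \<in> S \<Longrightarrow> \<omega> n = \<omega>' n"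
    and L2: "L2_on S f" "L2_on S g"
    and k: "\<And>c. c \<in> S \<Longrightarrow> eventually (\<lambda>t. wronskian f g t = k) (at c)" "k \<noteq> 0"
  shows "L2_on S h"
proof -
  obtain k1 where k1: "\<And>c. c \<in> S \<Longrightarrow> eventually (\<lambda>t. wronskian g h t = k1) (at c)"
    by (rule wronskian_constant_across[OF g h S eq[symmetric]]) blast+
  obtain k2 where k2: "\<And>c. c \<in> S \<Longrightarrow> eventually (\<lambda>t. wronskian h f t = k2) (at c)"
    by (rule wronskian_constant_across[OF h f S refl]) blast
  show ?thesis
  proof (rule L2_on_combination[OF L2])
    show "S \<in> sets borel"
      using S(1) by simp
    fix c assume c: "c \<in> S"
    then have cJ: "c \<in> J"
      using S(4) by blast
    have "eventually (\<lambda>t. h t * k + f t * k1 + g t * k2 = 0) (at c)"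
      using k(1)[OF c] k1[OF c] k2[OF c]
    proof eventually_elim
      case (elim t)
      have "h t * wronskian f g t + f t * wronskian g h t + g t * wronskian h f t = 0"
        by (simp add: algebra_simps)
      with elim show ?case
        by simp
    qed
    then have "((\<lambda>t. h t * k + f t * k1 + g t * k2) \<longlongrightarrow> 0) (at c)"
      by (rule tendsto_eventually)
    moreover have "((\<lambda>t. h t * k + f t * k1 + g t * k2) \<longlongrightarrow> h c * k + f c * k1 + g c * k2) (at c)"
      using solution_continuous[OF f cJ] solution_continuous[OF g cJ] solution_continuous[OF h cJ]
      unfolding isCont_def by (intro tendsto_intros)
    ultimately have "h c * k + f c * k1 + g c * k2 = 0"
      using tendsto_unique[of "at c"] by force
    then have "h c * k = - (f c * k1 + g c * k2)"
      by (simp only: eq_neg_iff_add_eq_0 add.assoc)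
    moreover have "h c = h c * k / k"
      using k(2) by simp
    ultimately have "h c = - (f c * k1 + g c * k2) / k"
      by simp
    then show "h c = (- k1 / k) * f c + (- k2 / k) * g c"
      by (simp add: diff_divide_distrib mult.commute)
  qed
qed

lemma wronskian_value:
  assumes f: "solution a b V I x \<omega> z f" and g: "solution a b V I x \<omega>' z g"
    and c: "c \<in> J - M" and k: "eventually (\<lambda>t. wronskian f g t = k) (at c)"
  shows "wronskian f g c = k"
proof -
  have "isCont f c" "isCont g c"
    using solution_continuous[OF f] solution_continuous[OF g] c by auto
  then have "(wronskian f g \<longlongrightarrow> wronskian f g c) (at c)"
    using solution_deriv_continuous[OF f c] solution_deriv_continuous[OF g c]
    unfolding isCont_def by (intro tendsto_intros)
  then show ?thesis
    using tendsto_eventually[OF k] tendsto_unique[of "at c"] by force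
qed

lemma H_domD:
  assumes "f \<in> H_dom a b V I x \<theta> \<gamma> \<omega>"
  shows "L2_on J f" 
    "regular_left a b V M \<Longrightarrow> boundary_condition (at_right (real_of_ereal a)) \<theta> f"
    "regular_right a b V M \<Longrightarrow> boundary_condition (at_left (real_of_ereal b)) \<gamma> f"
    "AE t in lebesgue_on J. tau V f t = z * f t \<Longrightarrow> solution a b V I x \<omega> z f"
proof -
  have f: "f \<in> T_dom a b V I x \<omega>"
    using assms by (simp add: H_dom_def)
  then show "L2_on J f"
    by (simp add: T_dom_def)
  show "regular_left a b V M \<Longrightarrow> boundary_condition (at_right (real_of_ereal a)) \<theta> f"
    "regular_right a b V M \<Longrightarrow> boundary_condition (at_left (real_of_ereal b)) \<gamma> f"
    using assms by (simp_all add: H_dom_def)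
  show "solution a b V I x \<omega> z f" if "AE t in lebesgue_on J. tau V f t = z * f t"
    using f that by (simp add: T_dom_def solution_def)
qed

lemma eventually_off_points:
  assumes "c \<in> J"
  shows "eventually (\<lambda>t. t \<notin> M) (at_left c)" "eventually (\<lambda>t. t \<notin> M) (at_right c)"
  using x_discrete[OF assms] by (simp_all add: islimpt_iff_eventually eventually_at_split)

text \<open>At a regular endpoint the constant value of the Wronskian is its boundary limit, which is \<open>0\<close>. In
the limit point case there is a solution that is not square integrable near the endpoint; by
\<open>third_solution_L2\<close> a nonzero Wronskian would exclude it.\<close>

lemma wronskian_vanishes_left:
  assumes f: "f \<in> H_dom a b V I x \<theta> \<gamma> \<omega>" "solution a b V I x \<omega> z f"
    and g: "g \<in> H_dom a b V I x \<theta> \<gamma> \<omega>'" "solution a b V I x \<omega>' z g"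
    and c: "c \<in> J" and eq: "\<And>n. n \<in> I \<Longrightarrow> x n < c \<Longrightarrow> \<omega> n = \<omega>' n"
    and endpoint: "regular_left a b V M \<or> lpc_left a b V I x \<omega>"
  shows "eventually (\<lambda>t. wronskian f g t = 0) (at_left c)"
proof -
  define S where "S = einterval a (ereal c)"
  have ac: "a < ereal c" "ereal c < b"
    using c by (simp_all add: einterval_iff)
  have S: "open S" "connected S" "S \<noteq> {}" "S \<subseteq> J"
    using einterval_nonempty[OF ac(1)] connected_einterval einterval_mono[of a a "ereal c" b] ac(2)
    by (auto simp: S_def)
  have eqS: "\<omega> n = \<omega>' n" if "n \<in> I" "x n \<in> S" for n
    using that eq by (auto simp: S_def einterval_iff)
  obtain k where k: "\<And>s. s \<in> S \<Longrightarrow> eventually (\<lambda>t. wronskian f g t = k) (at s)"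
    by (rule wronskian_constant_across[OF f(2) g(2) S eqS]) blast+
  have val: "wronskian f g t = k" if "t \<in> S" "t \<notin> M" for t
    using that S(4) by (intro wronskian_value[OF f(2) g(2) _ k]) auto
  have k0: "k = 0"
    using endpoint
  proof
    assume reg: "regular_left a b V M"
    then obtain a0 where a0: "a = ereal a0" "\<not> a0 islimpt M"
      unfolding regular_left_def by (cases a) auto
    have "eventually (\<lambda>t. t \<notin> M) (at_right a0)"
      using a0(2) by (simp add: islimpt_iff_eventually eventually_at_split)
    moreover have "a0 < c"
      using c a0(1) by (simp add: einterval_iff)
    then have "eventually (\<lambda>t. t \<in> S) (at_right a0)"
      unfolding S_def a0(1) by (auto intro: eventually_at_rightI)
    ultimately have "eventually (\<lambda>t. wronskian f g t = k) (at_right a0)"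
      by eventually_elim (rule val)
    moreover have "boundary_condition (at_right a0) \<theta> f" "boundary_condition (at_right a0) \<theta> g"
      using H_domD(2)[OF f(1) reg] H_domD(2)[OF g(1) reg] by (simp_all add: a0(1))
    ultimately show ?thesis
      using boundary_condition_wronskian trivial_limit_at_right_real by blast
  next
    assume "lpc_left a b V I x \<omega>"
    then obtain h where h: "solution a b V I x \<omega> z h" "\<not> L2_on S h"
      unfolding lpc_left_def S_def using c by blast
    have SJ: "S \<in> sets borel" "J \<in> sets borel"
      using S(1) by auto
    show ?thesis
    proof (rule ccontr)
      assume "k \<noteq> 0"
      then have "L2_on S h"
        by (intro third_solution_L2[OF f(2) g(2) h(1) S eqS _ _ k] 
            L2_on_subset[OF H_domD(1)[OF f(1)] S(4) SJ] L2_on_subset[OF H_domD(1)[OF g(1)] S(4) SJ])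
      with h(2) show False ..
    qed
  qed
  obtain s where "s \<in> S"
    using S(3) by blast
  then have "s < c" "\<And>t. s < t \<Longrightarrow> t < c \<Longrightarrow> t \<in> S"
    using less_trans[of a "ereal s"] by (auto simp: S_def einterval_iff)
  then have "eventually (\<lambda>t. t \<in> S) (at_left c)"
    unfolding eventually_at_left_field by blast
  with eventually_off_points(1)[OF c] show ?thesis
    by eventually_elim (use val k0 in auto)
qed

text \<open>The mirror image of \<open>wronskian_vanishes_left\<close>.\<close>

lemma wronskian_vanishes_right:
  assumes f: "f \<in> H_dom a b V I x \<theta> \<gamma> \<omega>" "solution a b V I x \<omega> z f"
    and g: "g \<in> H_dom a b V I x \<theta> \<gamma> \<omega>'" "solution a b V I x \<omega>' z g"
    and c: "c \<in> J" and eq: "\<And>n. n \<in> I \<Longrightarrow> c < x n \<Longrightarrow> \<omega> n = \<omega>' n"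
    and endpoint: "regular_right a b V M \<or> lpc_right a b V I x \<omega>"
  shows "eventually (\<lambda>t. wronskian f g t = 0) (at_right c)"
proof -
  define S where "S = einterval (ereal c) b"
  have ac: "a < ereal c" "ereal c < b"
    using c by (simp_all add: einterval_iff)
  have S: "open S" "connected S" "S \<noteq> {}" "S \<subseteq> J"
    using einterval_nonempty[OF ac(2)] connected_einterval einterval_mono[of a "ereal c" b b] ac(1)
    by (auto simp: S_def)
  have eqS: "\<omega> n = \<omega>' n" if "n \<in> I" "x n \<in> S" for n
    using that eq by (auto simp: S_def einterval_iff)
  obtain k where k: "\<And>s. s \<in> S \<Longrightarrow> eventually (\<lambda>t. wronskian f g t = k) (at s)"
    by (rule wronskian_constant_across[OF f(2) g(2) S eqS]) blast+
  have val: "wronskian f g t = k" if "t \<in> S" "t \<notin> M" for t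
    using that S(4) by (intro wronskian_value[OF f(2) g(2) _ k]) auto
  have k0: "k = 0"
    using endpoint
  proof
    assume reg: "regular_right a b V M"
    then obtain b0 where b0: "b = ereal b0" "\<not> b0 islimpt M"
      unfolding regular_right_def by (cases b) auto
    have "eventually (\<lambda>t. t \<notin> M) (at_left b0)"
      using b0(2) by (simp add: islimpt_iff_eventually eventually_at_split)
    moreover have "c < b0"
      using c b0(1) by (simp add: einterval_iff)
    then have "eventually (\<lambda>t. t \<in> S) (at_left b0)"
      unfolding S_def b0(1) by (auto intro: eventually_at_leftI)
    ultimately have "eventually (\<lambda>t. wronskian f g t = k) (at_left b0)"
      by eventually_elim (rule val)
    moreover have "boundary_condition (at_left b0) \<gamma> f" "boundary_condition (at_left b0) \<gamma> g"
      using H_domD(3)[OF f(1) reg] H_domD(3)[OF g(1) reg] by (simp_all add: b0(1))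
    ultimately show ?thesis
      using boundary_condition_wronskian trivial_limit_at_left_real by blast
  next
    assume "lpc_right a b V I x \<omega>"
    then obtain h where h: "solution a b V I x \<omega> z h" "\<not> L2_on S h"
      unfolding lpc_right_def S_def using c by blast
    have SJ: "S \<in> sets borel" "J \<in> sets borel"
      using S(1) by auto
    show ?thesis
    proof (rule ccontr)
      assume "k \<noteq> 0"
      then have "L2_on S h"
        by (intro third_solution_L2[OF f(2) g(2) h(1) S eqS _ _ k] 
            L2_on_subset[OF H_domD(1)[OF f(1)] S(4) SJ] L2_on_subset[OF H_domD(1)[OF g(1)] S(4) SJ])
      with h(2) show False ..
    qed
  qed
  obtain s where "s \<in> S"
    using S(3) by blast
  then have "c < s" "\<And>t. c < t \<Longrightarrow> t < s \<Longrightarrow> t \<in> S"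
    using less_trans[of _ "ereal s" b] by (auto simp: S_def einterval_iff)
  then have "eventually (\<lambda>t. t \<in> S) (at_right c)"
    unfolding eventually_at_right_field by blast
  with eventually_off_points(2)[OF c] show ?thesis
    by eventually_elim (use val k0 in auto)
qed

section \<open>Moving a single coupling\<close>

text \<open>The Wronskian vanishes on both sides of \<open>x n\<close>, so its jump there vanishes, and \<open>f\<close> or \<open>g\<close> has a
zero at \<open>x n\<close>. If \<open>f\<close> had none, all Cauchy data of \<open>g\<close> at \<open>x n\<close> from the left would vanish and
\<open>g\<close> would be trivial.\<close>

lemma eigenfunction_vanishes_at_movable_coupling:
  assumes f: "f \<in> H_dom a b V I x \<theta> \<gamma> \<omega>" "solution a b V I x \<omega> z f"
    and g: "g \<in> H_dom a b V I x \<theta> \<gamma> \<omega>'" "solution a b V I x \<omega>' z g"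
    and n: "n \<in> I" and eq: "\<And>m. m \<in> I \<Longrightarrow> m \<noteq> n \<Longrightarrow> \<omega> m = \<omega>' m" and neq: "\<omega> n \<noteq> \<omega>' n"
    and left: "regular_left a b V M \<or> lpc_left a b V I x \<omega>"
    and right: "regular_right a b V M \<or> lpc_right a b V I x \<omega>"
    and nontriv: "\<exists>t\<in>J. g t \<noteq> 0"
  shows "f (x n) = 0"
proof (rule ccontr)
  assume fn: "f (x n) \<noteq> 0"
  define c where "c = x n"
  have c: "c \<in> J"
    using n x_inside by (auto simp: c_def)
  have W: "eventually (\<lambda>t. wronskian f g t = 0) (at_left c)" "eventually (\<lambda>t. wronskian f g t = 0) (at_right c)"
    using wronskian_vanishes_left[OF f g c _ left] wronskian_vanishes_right[OF f g c _ right] eq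
    by (auto simp: c_def)
  obtain k l where kl: "eventually (\<lambda>t. wronskian f g t = k) (at_left c)"
    "eventually (\<lambda>t. wronskian f g t = l) (at_right c)"
    "l - k = of_real (jump \<omega>' c - jump \<omega> c) * f c * g c"
    by (rule wronskian_jump[OF f(2) g(2) c])
  have "k = 0"
    using eventually_conj[OF W(1) kl(1)] by (auto dest!: eventually_happens)
  moreover have "l = 0"
    using eventually_conj[OF W(2) kl(2)] by (auto dest!: eventually_happens)
  ultimately have gc: "g c = 0"
    using kl(3) fn neq by (simp add: c_def jump_x[OF n])
  obtain l r where lr: "(D1 g \<longlongrightarrow> l) (at_left c)" "(D1 g \<longlongrightarrow> r) (at_right c)"
    by (rule solution_one_sided_derivs[OF g(2) c])
  obtain l' r' where lr': "(D1 f \<longlongrightarrow> l') (at_left c)" "(D1 f \<longlongrightarrow> r') (at_right c)"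
    by (rule solution_one_sided_derivs[OF f(2) c])
  have "(f \<longlongrightarrow> f c) (at_left c)" "(g \<longlongrightarrow> g c) (at_left c)"
    using solution_continuous[OF f(2) c] solution_continuous[OF g(2) c]
    by (auto simp: isCont_def filterlim_at_split)
  then have "(wronskian f g \<longlongrightarrow> f c * l - l' * g c) (at_left c)"
    by (intro tendsto_intros lr lr')
  then have "f c * l - l' * g c = 0"
    using tendsto_eventually[OF W(1)] tendsto_unique[OF trivial_limit_at_left_real] by blast
  then have "l = 0"
    using gc fn by (simp add: c_def)
  then have "\<forall>t\<in>J. g t = 0"
    using solution_vanishes_if_cauchy_data_vanish[OF g(2) c gc] lr(1) by simp
  with nontriv show False
    by blast
qed

section \<open>Solutions that vanish at all interaction points\<close>

text \<open>Where \<open>f\<close> vanishes, the jump condition says that the one-sided derivatives agree.\<close>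

lemma solution_vanishing_at_points_is_C1:
  assumes f: "solution a b V I x \<omega> z f" and zero: "\<And>n. n \<in> I \<Longrightarrow> f (x n) = 0" and c: "c \<in> J"
  shows "(f has_vector_derivative D1 f c) (at c)" "isCont (D1 f) c"
proof -
  obtain l r where lr: "(D1 f \<longlongrightarrow> l) (at_left c)" "(D1 f \<longlongrightarrow> r) (at_right c)"
     "r - l = of_real (jump \<omega> c) * f c"
    by (rule solution_one_sided_derivs[OF f c])
  have "of_real (jump \<omega> c) * f c = 0"
    using zero jump_notin by (cases "c \<in> M") auto
  with lr(3) have "r = l"
    by simp
  with lr(1,2) have lim: "(D1 f \<longlongrightarrow> l) (at c)"
    by (simp add: filterlim_at_split)
  have "eventually (\<lambda>t. t \<in> J - M) (at c)"
    using eventually_off_points[OF c] eventually_at_in_open'[OF open_einterval c]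
    by (auto simp: eventually_at_split elim: eventually_elim2)
  then have "eventually (\<lambda>t. (f has_vector_derivative D1 f t) (at t)) (at c)"
    by eventually_elim (rule solution_deriv[OF f])
  then have der: "(f has_vector_derivative l) (at c)"
    by (rule has_vector_derivative_of_limit[OF solution_continuous[OF f c] _ lim])
  then have "D1 f c = l"
    by (rule vector_derivative_at)
  with der lim show "(f has_vector_derivative D1 f c) (at c)" "isCont (D1 f) c"
    by (simp_all add: isCont_def)
qed

text \<open>The integral equation for \<open>D1 f\<close>, known between consecutive interaction points, continues across
them: the difference \<open>G\<close> of its two sides is continuous and locally constant off the points, hence
constant.\<close>

lemma solution_vanishing_at_points_deriv_increment:
  assumes f: "solution a b V I x \<omega> z f" and zero: "\<And>n. n \<in> I \<Longrightarrow> f (x n) = 0"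
    and cd: "{c..d} \<subseteq> J" "c \<le> d"
    and q: "(\<lambda>\<tau>. (of_real (V \<tau>) - z) * f \<tau>) integrable_on {c..d}"
  shows "integral {c..d} (\<lambda>\<tau>. (of_real (V \<tau>) - z) * f \<tau>) = D1 f d - D1 f c"
proof (cases "c = d")
  case False
  then have "c < d"
    using cd(2) by simp
  define q where "q \<tau> = (of_real (V \<tau>) - z) * f \<tau>" for \<tau>
  define G where "G t = D1 f t - integral {c..t} q" for t
  have qi: "q integrable_on {c..d}"
    using assms(5) by (simp add: q_def[abs_def])
  have "continuous_on {c..d} (D1 f)"
    using solution_vanishing_at_points_is_C1(2)[OF f zero] cd(1)
    by (auto intro!: continuous_at_imp_continuous_on)
  then have G: "continuous_on {c..d} G"
    unfolding G_def[abs_def] by (intro continuous_intros indefinite_integral_continuous_1 qi)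
  have Gc: "(G \<longlongrightarrow> G r) (at r)" if "r \<in> {c<..<d}" for r
    using continuous_on_interior[OF G, of r] that by (simp add: isCont_def)
  have flat: "G t = G s" if st: "{s..t} \<subseteq> J - M" "s \<le> t" "c \<le> s" "t \<le> d" for s t
  proof -
    have "integral {c..s} q + integral {s..t} q = integral {c..t} q"
      using st by (intro Henstock_Kurzweil_Integration.integral_combine integrable_on_subinterval[OF qi]) auto
    moreover have "integral {s..t} q = D1 f t - D1 f s"
      using solution_integral(2)[OF f st(1,2)] by (simp add: q_def[abs_def] integral_unique)
    ultimately show ?thesis
      by (simp add: G_def algebra_simps)
  qed
  have loc: "eventually (\<lambda>t. G t = G r) (at r)" if r: "r \<in> {c<..<d}" for r
  proof -
    have rJ: "r \<in> J"
      using r cd(1) by auto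
    obtain \<delta> where \<delta>: "\<delta> > 0" "{r-\<delta>..r+\<delta>} \<subseteq> J" "M \<inter> {r-\<delta>..r+\<delta>} \<subseteq> {r}"
      by (rule isolating_interval[OF rJ, of 0]) blast
    define e where "e = min \<delta> (min (r - c) (d - r))"
    have e: "e > 0" "e \<le> \<delta>" "e \<le> r - c" "e \<le> d - r"
      using \<delta>(1) r by (auto simp: e_def)
    have gap: "G t = G s" if "s \<le> t" "r - e < s" "t < r + e" "t < r \<or> r < s" for s t
    proof (rule flat)
      show "{s..t} \<subseteq> J - M"
      proof
        fix y assume "y \<in> {s..t}"
        then have "y \<in> {r-\<delta>..r+\<delta>}" "y \<noteq> r"
          using that e by auto
        then show "y \<in> J - M"
          using \<delta>(2,3) by blast
      qed
    qed (use that e in auto)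
    have half: "eventually (\<lambda>t. G t = G r) H"
      if ev: "eventually (\<lambda>t. G t = k) H" and H: "H \<le> at r" "H \<noteq> bot" for H k
    proof -
      have "G r = k"
        using tendsto_unique[OF H(2) tendsto_mono[OF H(1) Gc[OF r]] tendsto_eventually[OF ev]] .
      with ev show ?thesis
        by simp
    qed
    define kl where "kl = G (r - e/2)"
    define kr where "kr = G (r + e/2)"
    have "eventually (\<lambda>t. G t = kl) (at_left r)"
    proof -
      have "G t = kl" if "r - e < t" "t < r" for t
        unfolding kl_def using gap[of t "r - e/2"] gap[of "r - e/2" t] that e(1) by (cases "t \<le> r - e/2") auto
      then show ?thesis
        using e(1) unfolding eventually_at_left_field by (intro exI[of _ "r - e"]) auto
    qed
    moreover have "eventually (\<lambda>t. G t = kr) (at_right r)"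
    proof -
      have "G t = kr" if "r < t" "t < r + e" for t
        unfolding kr_def using gap[of t "r + e/2"] gap[of "r + e/2" t] that e(1) by (cases "t \<le> r + e/2") auto
      then show ?thesis
        using e(1) unfolding eventually_at_right_field by (intro exI[of _ "r + e"]) auto
    qed
    ultimately have "eventually (\<lambda>t. G t = G r) (at_left r)" "eventually (\<lambda>t. G t = G r) (at_right r)"
      using half[of kl "at_left r"] half[of kr "at_right r"] by (simp_all add: at_le)
    then show ?thesis
      by (simp add: eventually_at_split)
  qed
  obtain k where k: "\<And>r. r \<in> {c<..<d} \<Longrightarrow> eventually (\<lambda>t. G t = k) (at r)"
  proof (rule locally_constant_off_points_imp_constant[of "{c<..<d}" G])
    show "{c<..<d} \<noteq> {}"
      using \<open>c < d\<close> by simp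
    show "\<exists>k. eventually (\<lambda>t. G t = k) (at r)" if "r \<in> {c<..<d}" for r
      using loc[OF that] by blast
  qed auto
  have Gk: "G r = k" if "r \<in> {c<..<d}" for r
    using eventually_conj[OF k[OF that] loc[OF that]] by (auto dest!: eventually_happens)
  have closed: "closed {r \<in> {c..d}. G r = k}"
    using continuous_closed_preimage_constant[OF G, of k] by simp
  have "closure {c<..<d} \<subseteq> {r \<in> {c..d}. G r = k}"
    by (rule closure_minimal[OF _ closed]) (use Gk in auto)
  then have "{c..d} \<subseteq> {r \<in> {c..d}. G r = k}"
    using \<open>c < d\<close> by (simp add: closure_greaterThanLessThan)
  then have "G c = k" "G d = k"
    using subsetD[of "{c..d}" _ c] subsetD[of "{c..d}" _ d] cd(2) by auto
  then show ?thesis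
    by (simp add: G_def q_def[abs_def] algebra_simps)
qed simp

text \<open>It remains to see that \<open>f\<close> and \<open>D1 f\<close> are absolutely continuous on intervals containing
interaction points. Both are indefinite integrals of integrable functions there.\<close>

lemma solution_vanishing_at_points_is_classical:
  assumes f: "solution a b V I x \<omega> z f" and zero: "\<And>n. n \<in> I \<Longrightarrow> f (x n) = 0"
  shows "classical_solution a b V z f"
proof -
  have C1: "(f has_vector_derivative D1 f t) (at t)" "isCont (D1 f) t" if "t \<in> J" for t
    using solution_vanishing_at_points_is_C1[OF f _ that] zero by blast+
  have cont: "continuous_on {c..d} f" "continuous_on {c..d} (D1 f)" if "{c..d} \<subseteq> J" for c d
    using that solution_continuous[OF f] C1(2) by (auto intro!: continuous_at_imp_continuous_on)
  have "abs_continuous_on {c..d} f" if cd: "{c..d} \<subseteq> J" for c d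
  proof (rule abs_continuous_on_indefinite_integral[where q = "D1 f"])
    show "D1 f absolutely_integrable_on {c..d}"
      using cont(2)[OF cd] by (rule absolutely_integrable_continuous_real)
    fix s t assume st: "c \<le> s" "s \<le> t" "t \<le> d"
    show "(D1 f has_integral f t - f s) {s..t}"
    proof (rule fundamental_theorem_of_calculus[OF st(2)])
      fix r assume "r \<in> {s..t}"
      then have "r \<in> J"
        using st cd by auto
      then show "(f has_vector_derivative D1 f r) (at r within {s..t})"
        using C1(1) has_vector_derivative_at_within by blast
    qed
  qed
  moreover have "abs_continuous_on {c..d} (D1 f)" if cd: "{c..d} \<subseteq> J" for c d
  proof (rule abs_continuous_on_indefinite_integral)
    have "(\<lambda>\<tau>. f \<tau> * (of_real (V \<tau>) - z)) absolutely_integrable_on {c..d}"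
    proof (rule absolutely_integrable_bounded_measurable_product[OF bilinear_times])
      show "f \<in> borel_measurable (lebesgue_on {c..d})"
        using cont(1)[OF cd] by (rule continuous_imp_measurable_on_sets_lebesgue) simp
      show "bounded (f ` {c..d})"
        using cont(1)[OF cd] by (intro compact_imp_bounded compact_continuous_image) auto
    qed (use V_minus_integrable[OF cd] in auto)
    then show q: "(\<lambda>\<tau>. (of_real (V \<tau>) - z) * f \<tau>) absolutely_integrable_on {c..d}"
      by (simp add: mult.commute)
    fix s t assume st: "c \<le> s" "s \<le> t" "t \<le> d"
    then have sub: "{s..t} \<subseteq> {c..d}"
      by auto
    have "(\<lambda>\<tau>. (of_real (V \<tau>) - z) * f \<tau>) integrable_on {s..t}"
      using q unfolding absolutely_integrable_on_def by (intro integrable_on_subinterval[OF _ sub]) blast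
    with solution_vanishing_at_points_deriv_increment[OF f zero subset_trans[OF sub cd] st(2)]
    show "((\<lambda>\<tau>. (of_real (V \<tau>) - z) * f \<tau>) has_integral (D1 f t - D1 f s)) {s..t}"
      by (simp add: has_integral_iff)
  qed
  moreover have "f differentiable (at t)" if "t \<in> J" for t
    using C1(1)[OF that] by (rule differentiableI_vector)
  ultimately show ?thesis
    using f unfolding solution_def regularity_off_def loc_abs_continuous_on_def by simp
qed

end

section \<open>Movable coordinates in sets of positive measure\<close>

text \<open>Fubini's theorem for the factor \<open>n\<close> against all the others. The function \<open>s\<close>, the measure of the
section of \<open>B\<close> in direction \<open>n\<close>, does not depend on the coordinate \<open>n\<close>; hence each section of the set in
question is either contained in a null section of \<open>B\<close> or empty.\<close>

lemma null_section_part_is_null: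
  fixes p :: "'i \<Rightarrow> 'a measure"
  assumes p: "\<And>i. i \<in> I \<Longrightarrow> prob_space (p i)" and n: "n \<in> I" and B: "B \<in> sets (PiM I p)"
  shows "{w \<in> B. emeasure (p n) {r \<in> space (p n). w(n := r) \<in> B} = 0} \<in> null_sets (PiM I p)"
proof -
  define I' where "I' = I - {n}"
  have I: "I = insert n I'" "n \<notin> I'"
    using n by (auto simp: I'_def)
  interpret pn: prob_space "p n"
    using p n by blast
  interpret P': prob_space "PiM I' p"
    by (rule prob_space_PiM) (use p in \<open>auto simp: I'_def\<close>)
  interpret pair: pair_sigma_finite "p n" "PiM I' p"
    by unfold_locales
  define s where "s w = emeasure (p n) {r \<in> space (p n). w(n := r) \<in> B}" for w
  define N where "N = {w \<in> B. s w = 0}"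
  have "(\<lambda>y. (fst y)(n := snd y)) \<in> measurable (PiM I p \<Otimes>\<^sub>M p n) (PiM I p)"
    by (rule measurable_fun_upd[of _ I]) (use n in auto)
  then have "(\<lambda>y. (fst y)(n := snd y)) -` B \<inter> space (PiM I p \<Otimes>\<^sub>M p n) \<in> sets (PiM I p \<Otimes>\<^sub>M p n)"
    using B by (rule measurable_sets)
  then have "(\<lambda>w. emeasure (p n) (Pair w -` ((\<lambda>y. (fst y)(n := snd y)) -` B \<inter> space (PiM I p \<Otimes>\<^sub>M p n))))
      \<in> borel_measurable (PiM I p)"
    by (rule pn.measurable_emeasure_Pair)
  moreover have "Pair w -` ((\<lambda>y. (fst y)(n := snd y)) -` B \<inter> space (PiM I p \<Otimes>\<^sub>M p n)) = {r \<in> space (p n). w(n := r) \<in> B}"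
    if "w \<in> space (PiM I p)" for w
    using that by (auto simp: space_pair_measure)
  ultimately have s: "s \<in> borel_measurable (PiM I p)"
    unfolding s_def[abs_def] by (simp cong: measurable_cong)
  have "{w \<in> space (PiM I p). s w = 0} \<in> sets (PiM I p)"
    using s by measurable
  moreover have "N = B \<inter> {w \<in> space (PiM I p). s w = 0}"
    using sets.sets_into_space[OF B] by (auto simp: N_def)
  ultimately have N: "N \<in> sets (PiM I p)"
    using B by simp
  have upd: "(\<lambda>(r, X). X(n := r)) \<in> measurable (p n \<Otimes>\<^sub>M PiM I' p) (PiM I p)"
    unfolding split_beta by (rule measurable_fun_upd[of _ I']) (use I in auto)
  have distr: "distr (p n \<Otimes>\<^sub>M PiM I' p) (PiM I p) (\<lambda>(r, X). X(n := r)) = PiM I p"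
    using distr_pair_PiM_eq_PiM[of I' p n] p n unfolding I(1)[symmetric] by (auto simp: I'_def)
  let ?Q = "(\<lambda>(r, X). X(n := r)) -` N \<inter> space (p n \<Otimes>\<^sub>M PiM I' p)"
  have Q: "?Q \<in> sets (p n \<Otimes>\<^sub>M PiM I' p)"
    using upd N by (rule measurable_sets)
  have "emeasure (PiM I p) N = emeasure (p n \<Otimes>\<^sub>M PiM I' p) ?Q"
    by (subst distr[symmetric]) (rule emeasure_distr[OF upd N])
  also have "\<dots> = (\<integral>\<^sup>+X. emeasure (p n) ((\<lambda>r. (r, X)) -` ?Q) \<partial>PiM I' p)"
    by (rule pair.emeasure_pair_measure_alt2[OF Q])
  also have "\<dots> = (\<integral>\<^sup>+X. 0 \<partial>PiM I' p)"
  proof (rule nn_integral_cong)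
    fix X assume X: "X \<in> space (PiM I' p)"
    have sub: "(\<lambda>r. (r, X)) -` ?Q \<subseteq> {r \<in> space (p n). X(n := r) \<in> B}"
      by (auto simp: space_pair_measure N_def)
    have meas: "(\<lambda>r. (r, X)) -` ?Q \<in> sets (p n)"
      by (rule sets_Pair2[OF Q])
    have "s (X(n := r)) = s X" for r
      by (simp add: s_def)
    then have empty: "(\<lambda>r. (r, X)) -` ?Q = {}" if "s X \<noteq> 0"
      using that by (auto simp: N_def)
    show "emeasure (p n) ((\<lambda>r. (r, X)) -` ?Q) = 0"
    proof (cases "s X = 0")
      case True
      have "(\<lambda>r. X(n := r)) \<in> measurable (p n) (PiM I p)"
        by (rule measurable_fun_upd[of _ I']) (use I X in auto)
      then have "(\<lambda>r. X(n := r)) -` B \<inter> space (p n) \<in> sets (p n)"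
        using B by (rule measurable_sets)
      then have "{r \<in> space (p n). X(n := r) \<in> B} \<in> sets (p n)"
        by (simp add: vimage_def Int_def conj_commute)
      then have "emeasure (p n) ((\<lambda>r. (r, X)) -` ?Q) \<le> s X"
        unfolding s_def by (rule emeasure_mono[OF sub])
      with True show ?thesis
        by simp
    next
      case False
      then show ?thesis
        unfolding empty[OF False] by simp
    qed
  qed
  finally show ?thesis
    using N by (simp add: N_def s_def null_sets_def)
qed

text \<open>After removing the countably many null sets of the preceding lemma from the measurable part
of \<open>B\<close>, a point remains. Its section in each direction has positive measure, so it is not contained in
a singleton.\<close>

lemma positive_set_has_point_with_movable_coordinates:
  fixes p :: "'i \<Rightarrow> real measure"
  assumes "countable I"
    and p: "\<And>i. i \<in> I \<Longrightarrow> prob_space (p i)" "\<And>i. i \<in> I \<Longrightarrow> sets (p i) = sets borel"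
      "\<And>i r. i \<in> I \<Longrightarrow> emeasure (p i) {r} = 0"
    and B: "B \<in> sets (completion (PiM I p))" "emeasure (completion (PiM I p)) B \<noteq> 0"
  obtains w where "w \<in> B" "\<And>n. n \<in> I \<Longrightarrow> \<exists>r. r \<noteq> w n \<and> w(n := r) \<in> B"
proof -
  let ?P = "PiM I p"
  define B0 where "B0 = main_part ?P B"
  have B0: "B0 \<in> sets ?P" "B0 \<subseteq> B" "emeasure ?P B0 \<noteq> 0"
    using B main_part_null_part_Un[OF B(1)] Un_upper1[of "main_part ?P B" "null_part ?P B"]
    by (simp_all add: B0_def emeasure_completion)
  define N where "N n = {w \<in> B0. emeasure (p n) {r \<in> space (p n). w(n := r) \<in> B0} = 0}" for n
  have "(\<Union>n\<in>I. N n) \<in> null_sets ?P"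
    using assms(1) null_section_part_is_null[OF p(1) _ B0(1)] by (intro null_sets_UN') (auto simp: N_def)
  then have "\<not> B0 \<subseteq> (\<Union>n\<in>I. N n)"
    using B0(1,3) null_sets_subset by (metis null_setsD1)
  then obtain w where w: "w \<in> B0" "\<And>n. n \<in> I \<Longrightarrow> w \<notin> N n"
    by blast
  show ?thesis
  proof (rule that[of w])
    show "w \<in> B"
      using w(1) B0(2) by blast
    fix n assume n: "n \<in> I"
    let ?R = "{r \<in> space (p n). w(n := r) \<in> B0}"
    have "emeasure (p n) ?R \<noteq> 0"
      using w(1) w(2)[OF n] by (auto simp: N_def)
    moreover have "emeasure (p n) ?R = 0" if "?R \<subseteq> {w n}"
      using emeasure_mono[OF that, of "p n"] p(2,3)[OF n] by simp
    ultimately obtain r where "r \<in> ?R" "r \<noteq> w n"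
      by blast
    then show "\<exists>r. r \<noteq> w n \<and> w(n := r) \<in> B"
      using B0(2) by blast
  qed
qed

section \<open>The point spectrum for random couplings\<close>

theorem theorem4p3:
  fixes a b :: ereal and V :: "real \<Rightarrow> real" and I :: "int set" and x :: "int \<Rightarrow> real"
    and p :: "int \<Rightarrow> real measure" and \<theta> \<gamma> E :: real
  assumes "a < b"
    and "L1_loc a b V"
    and "inj_on x I"
    and "x ` I \<subseteq> einterval a b"
    and "\<And>t. t \<in> einterval a b \<Longrightarrow> \<not> t islimpt (x ` I)"
    and "\<And>n. n \<in> I \<Longrightarrow> prob_space (p n)"
    and "\<And>n. n \<in> I \<Longrightarrow> sets (p n) = sets borel"
    and "\<And>n r. n \<in> I \<Longrightarrow> emeasure (p n) {r} = 0"
    and "\<And>\<omega>. \<omega> \<in> space (Omega I p) \<Longrightarrow> regular_left a b V (x ` I) \<or> lpc_left a b V I x \<omega>"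
    and "\<And>\<omega>. \<omega> \<in> space (Omega I p) \<Longrightarrow> regular_right a b V (x ` I) \<or> lpc_right a b V I x \<omega>"
    and "0 \<le> \<theta>" "\<theta> < pi" "0 \<le> \<gamma>" "\<gamma> < pi"
    and "nonoscillatory a b V E"
    and "countable (x ` I)" "infinite (x ` I)"
  shows "\<forall>B \<in> sets (Omega I p). B \<subseteq> A_set a b V I x \<theta> \<gamma> p E \<longrightarrow> emeasure (Omega I p) B = 0"
proof (intro ballI impI, rule ccontr)
  fix B assume B: "B \<in> sets (Omega I p)" "B \<subseteq> A_set a b V I x \<theta> \<gamma> p E" "emeasure (Omega I p) B \<noteq> 0"
  interpret point_interactions a b V I x
    using assms(2-5) by unfold_locales
  let ?z = "complex_of_real E"
  have coI: "countable I"
    by simp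
  obtain w where w: "w \<in> B" "\<And>n. n \<in> I \<Longrightarrow> \<exists>r. r \<noteq> w n \<and> w(n := r) \<in> B"
  proof (rule positive_set_has_point_with_movable_coordinates[OF coI, of p B])
    show "B \<in> sets (completion (PiM I p))" "emeasure (completion (PiM I p)) B \<noteq> 0"
      using B(1,3) by (simp_all add: Omega_def)
  qed (use assms(6-8) in auto)
  have eigen: "\<exists>f \<in> H_dom a b V I x \<theta> \<gamma> \<omega>. solution a b V I x \<omega> ?z f \<and> (\<exists>t\<in>J. f t \<noteq> 0)"
    if \<omega>: "\<omega> \<in> B" for \<omega>
  proof -
    obtain f where f: "f \<in> H_dom a b V I x \<theta> \<gamma> \<omega>" "\<not> (AE t in lebesgue_on J. f t = 0)"
        "AE t in lebesgue_on J. tau V f t = ?z * f t"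
      using \<omega> B(2) unfolding A_set_def H_point_spectrum_def point_spectrum_def by blast
    have "\<exists>t\<in>J. f t \<noteq> 0"
    proof (rule ccontr)
      assume "\<not> ?thesis"
      then have "AE t in lebesgue_on J. f t = 0"
        by (intro AE_I2) (auto simp: space_restrict_space)
      with f(2) show False ..
    qed
    with f(1) H_domD(4)[OF f(1,3)] show ?thesis
      by blast
  qed
  have wO: "w \<in> space (Omega I p)"
    using w(1) sets.sets_into_space[OF B(1)] by blast
  obtain f where f: "f \<in> H_dom a b V I x \<theta> \<gamma> w" "solution a b V I x w ?z f" "\<exists>t\<in>J. f t \<noteq> 0"
    using eigen[OF w(1)] by blast
  have zero: "f (x n) = 0" if n: "n \<in> I" for n
  proof -
    obtain r where r: "r \<noteq> w n" "w(n := r) \<in> B"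
      using w(2)[OF n] by blast
    obtain g where g: "g \<in> H_dom a b V I x \<theta> \<gamma> (w(n := r))" "solution a b V I x (w(n := r)) ?z g"
        "\<exists>t\<in>J. g t \<noteq> 0"
      using eigen[OF r(2)] by blast
    show ?thesis
      by (rule eigenfunction_vanishes_at_movable_coupling[OF f(1,2) g(1,2) n _ _ assms(9)[OF wO] assms(10)[OF wO] g(3)])
        (use r(1) in auto)
  qed
  have "classical_solution a b V ?z f"
    by (rule solution_vanishing_at_points_is_classical[OF f(2) zero])
  then have "finite {t \<in> J. f t = 0}"
    using \<open>nonoscillatory a b V E\<close> f(3) unfolding nonoscillatory_def by blast
  moreover have "M \<subseteq> {t \<in> J. f t = 0}"
    using zero x_inside by auto
  ultimately show False
    using \<open>infinite M\<close> finite_subset by blast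
qed

end
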